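(* Let $n\ge1$, let $c^n_{x,y}$ be the conductances of the set consisting of the bottom row $x_0,\dots,x_{2^n}$ of $V_n$ together with the top point $q_0$, write $c^n_{i,j}=c^n_{x_i,x_j}$, and set $b_n=c^n_{0,2^n}$. Then $c^n_{0,j}=2b_n$ for $2^{n-1}<j<2^n$; $c^n_{j,2^n}=2b_n$ for $0<j<2^{n-1}$; and $c^n_{i,j}=4b_n$ for $0<i<2^{n-1}$, $2^{n-1}<j<2^n$. Also, $$b_n=\frac{49\cdot25^n}{(5\cdot3^n+16\cdot10^n)(3^n+6\cdot10^n)}.$$
   Context: Let $q_0,q_1,q_2$ be the vertices of an equilateral triangle in the plane, $F_i(x)=\frac12(x+q_i)$, and let $SG$ (the Sierpinski gasket) be the unique nonempty compact set with $SG=\bigcup_{i}F_i(SG)$. For a word $w$ of length $m$ let $F_w=F_{w_1}\circ\cdots\circ F_{w_m}$. Put $V_0=\{q_0,q_1,q_2\}$, $V_m=\bigcup_iF_iV_{m-1}$; $x\sim_m y$ means $x\ne y$ and $x,y\in F_wV_0$ for some word $w$ of length $m$. The bottom row of $V_n$ consists of the points $x_i=q_1+\frac{i}{2^n}(q_2-q_1)$, $0\le i\le2^n$. The energy of a continuous $u:SG\to\mathbb{R}$ is $\mathcal{E}(u)=\lim_{m\to\infty}\left(\frac53\right)^m\sum_{\{x,y\}:x\sim_m y}(u(x)-u(y))^2$ (a nondecreasing limit), and $\operatorname{dom}\mathcal{E}$ is the set of continuous $u$ with $\mathcal{E}(u)<\infty$. For a nonempty set $A\subset V_n$ and values prescribed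 on $A$, there is a unique $u\in\operatorname{dom}\mathcal{E}$ of least energy with these values on $A$, and its energy has the form $\mathcal{E}(u)=\sum_{\{x,y\}\subset A}c_{x,y}(u(x)-u(y))^2$; the (uniquely determined, symmetric) coefficients $c_{x,y}$, $x\neq y$, are the conductances of $A$. *)

theory Defs
  imports "HOL-Analysis.Analysis"
begin

text \<open>A triangle is a function \<open>q :: nat \<Rightarrow> real^2\<close>, of which only the values
  \<open>q 0\<close>, \<open>q 1\<close>, \<open>q 2\<close> matter.\<close>

definition equilateral :: "(nat \<Rightarrow> real^2) \<Rightarrow> bool" where
  "equilateral q \<longleftrightarrow> q 0 \<noteq> q 1 \<and> dist (q 0) (q 1) = dist (q 1) (q 2)
     \<and> dist (q 1) (q 2) = dist (q 2) (q 0)"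

definition F :: "(nat \<Rightarrow> real^2) \<Rightarrow> nat \<Rightarrow> real^2 \<Rightarrow> real^2" where
  "F q i x = (1/2) *\<^sub>R (x + q i)"

definition SG :: "(nat \<Rightarrow> real^2) \<Rightarrow> (real^2) set" where
  "SG q = (THE K. K \<noteq> {} \<and> compact K \<and> K = (\<Union>i<3. F q i ` K))"

primrec Fw :: "(nat \<Rightarrow> real^2) \<Rightarrow> nat list \<Rightarrow> real^2 \<Rightarrow> real^2" where
  "Fw q [] = id"
| "Fw q (i # w) = F q i \<circ> Fw q w"

definition words :: "nat \<Rightarrow> nat list set" where
  "words m = {w. length w = m \<and> set w \<subseteq> {..<3}}"

primrec V :: "(nat \<Rightarrow> real^2) \<Rightarrow> nat \<Rightarrow> (real^2) set" where
  "V q 0 = q ` {..<3}"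
| "V q (Suc m) = (\<Union>i<3. F q i ` V q m)"

definition adj :: "(nat \<Rightarrow> real^2) \<Rightarrow> nat \<Rightarrow> real^2 \<Rightarrow> real^2 \<Rightarrow> bool" where
  "adj q m x y \<longleftrightarrow> x \<noteq> y \<and> (\<exists>w\<in>words m. x \<in> Fw q w ` V q 0 \<and> y \<in> Fw q w ` V q 0)"

text \<open>Sums over unordered pairs are written as half the sum over ordered pairs, here and
  in \<open>is_conductances\<close>.\<close>

definition graph_energy :: "(nat \<Rightarrow> real^2) \<Rightarrow> nat \<Rightarrow> (real^2 \<Rightarrow> real) \<Rightarrow> real" where
  "graph_energy q m u = (5/3)^m * ((\<Sum>(x, y)\<in>{(x, y). adj q m x y}. (u x - u y)^2) / 2)"

text \<open>A function on the gasket is represented by any function on the plane extending it;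
  the values off \<open>SG q\<close> are never used. The energy takes values in the extended reals, where
  the nondecreasing limit always exists.\<close>

definition energy :: "(nat \<Rightarrow> real^2) \<Rightarrow> (real^2 \<Rightarrow> real) \<Rightarrow> ereal" where
  "energy q u = lim (\<lambda>m. ereal (graph_energy q m u))"

definition dom_energy :: "(nat \<Rightarrow> real^2) \<Rightarrow> (real^2 \<Rightarrow> real) set" where
  "dom_energy q = {u. continuous_on (SG q) u \<and> energy q u < \<infinity>}"

definition is_min_extension ::
    "(nat \<Rightarrow> real^2) \<Rightarrow> (real^2) set \<Rightarrow> (real^2 \<Rightarrow> real) \<Rightarrow> (real^2 \<Rightarrow> real) \<Rightarrow> bool" where
  "is_min_extension q A f u \<longleftrightarrow>
     u \<in> dom_energy q \<and> (\<forall>x\<in>A. u x = f x) \<and>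
     (\<forall>v\<in>dom_energy q. (\<forall>x\<in>A. v x = f x) \<longrightarrow> energy q u \<le> energy q v)"

text \<open>The coefficients are only meaningful at pairs of distinct points of \<open>A\<close>; they are set
  to 0 elsewhere, which makes \<open>c\<close> unique as a function.\<close>

definition is_conductances ::
    "(nat \<Rightarrow> real^2) \<Rightarrow> (real^2) set \<Rightarrow> (real^2 \<Rightarrow> real^2 \<Rightarrow> real) \<Rightarrow> bool" where
  "is_conductances q A c \<longleftrightarrow>
     (\<forall>x y. c x y = c y x) \<and>
     (\<forall>x y. x \<notin> A \<or> y \<notin> A \<or> x = y \<longrightarrow> c x y = 0) \<and>
     (\<forall>f. \<exists>u. is_min_extension q A f u \<and>
        energy q u = ereal ((\<Sum>x\<in>A. \<Sum>y\<in>A. c x y * (u x - u y)^2) / 2))"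

definition conductance ::
    "(nat \<Rightarrow> real^2) \<Rightarrow> (real^2) set \<Rightarrow> real^2 \<Rightarrow> real^2 \<Rightarrow> real" where
  "conductance q A = (THE c. is_conductances q A c)"

definition bottom_pt :: "(nat \<Rightarrow> real^2) \<Rightarrow> nat \<Rightarrow> nat \<Rightarrow> real^2" where
  "bottom_pt q n i = q 1 + (real i / 2^n) *\<^sub>R (q 2 - q 1)"

definition row_and_top :: "(nat \<Rightarrow> real^2) \<Rightarrow> nat \<Rightarrow> (real^2) set" where
  "row_and_top q n = insert (q 0) (bottom_pt q n ` {0..2^n})"

definition row_conductance :: "(nat \<Rightarrow> real^2) \<Rightarrow> nat \<Rightarrow> nat \<Rightarrow> nat \<Rightarrow> real" where
  "row_conductance q n i j = conductance q (row_and_top q n) (bottom_pt q n i) (bottom_pt q n j)"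

definition b_end :: "(nat \<Rightarrow> real^2) \<Rightarrow> nat \<Rightarrow> real" where
  "b_end q n = row_conductance q n 0 (2^n)"

end

theory Submission
  imports Defs
begin

text \<open>By self-similarity, the energy of \<open>u\<close> is \<open>5/3\<close> times the sum of the energies of the
  three restrictions \<open>u \<circ> F\<^sub>i\<close>. By induction on the level, the least energy with given values on
  the bottom row and \<open>a\<close> at the top is \<open>d\<^sub>n (a - m)\<^sup>2 + R\<^sub>n\<close>, where \<open>m\<close> is the mean over the row
  (with half weight at its ends), and \<open>R\<^sub>n\<close> depends on the values in the row only: for one more
  level, the two free values at the midpoints of the upper sides are eliminated by completing
  squares, which gives \<open>d\<^sub>n\<^sub>+\<^sub>1 = (10/3) d\<^sub>n / (1 + d\<^sub>n)\<close> and couples the left and the right half of the row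
  through the square of the difference of their means only. The conductance between a point of the left
  and a point of the right half is therefore a constant times the product of the weights of the
  two points.\<close>

subsection \<open>The gasket\<close>

declare One_nat_def [simp del]

lemma F_eq_iff [simp]: "F q i x = F q i y \<longleftrightarrow> x = y"
  by (simp add: F_def)

lemma F_fixed [simp]: "F q i (q i) = q i"
  by (simp add: F_def flip: scaleR_2)

lemma F_swap: "F q i (q j) = F q j (q i)"
  by (simp add: F_def add.commute)

lemma dist_F: "dist (F q i x) (F q i y) = dist x y / 2"
proof -
  have "F q i x - F q i y = (1/2) *\<^sub>R (x - y)" by (simp add: F_def algebra_simps)
  then show ?thesis by (simp add: dist_norm)
qed

lemma continuous_on_F [continuous_intros]: "continuous_on S (F q i)"
  unfolding F_def by (intro continuous_intros)

definition F_inv :: "(nat \<Rightarrow> real^2) \<Rightarrow> nat \<Rightarrow> real^2 \<Rightarrow> real^2" where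
  "F_inv q i x = 2 *\<^sub>R x - q i"

lemma F_inv_F [simp]: "F_inv q i (F q i x) = x"
  by (simp add: F_inv_def F_def)

lemma lessThan_3: "{..<3::nat} = {0, 1, 2}"
  by auto

lemma less_3_cases: "i < 3 \<Longrightarrow> (i = 0 \<Longrightarrow> P) \<Longrightarrow> (i = 1 \<Longrightarrow> P) \<Longrightarrow> (i = 2 \<Longrightarrow> P) \<Longrightarrow> P" for i :: nat
  by linarith

lemma finite_V: "finite (V q m)"
  by (induction m) auto

lemma V_subset_Suc: "V q m \<subseteq> V q (Suc m)"
proof (induction m)
  case 0
  show ?case
  proof
    fix x assume "x \<in> V q 0"
    then obtain i where "i < 3" "x = F q i (q i)" by auto
    then show "x \<in> V q (Suc 0)" by (metis V.simps UN_I image_eqI lessThan_iff)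
  qed
next
  case (Suc m)
  have "(\<Union>i<3. F q i ` V q m) \<subseteq> (\<Union>i<3. F q i ` V q (Suc m))"
    by (intro UN_mono image_mono Suc subset_refl)
  then show ?case by (simp only: V.simps(2))
qed

text \<open>The points of all levels are dense in the gasket, so the closure of this set gives an
  explicit description of \<open>SG q\<close>.\<close>

definition V_star :: "(nat \<Rightarrow> real^2) \<Rightarrow> (real^2) set" where
  "V_star q = (\<Union>m. V q m)"

lemma vertex_in_V_star: "i < 3 \<Longrightarrow> q i \<in> V_star q"
  unfolding V_star_def by (auto intro: exI [of _ 0])

lemma V_star_fixed: "(\<Union>i<3. F q i ` V_star q) = V_star q"
proof -
  have "(\<Union>i<3. F q i ` V_star q) = (\<Union>m. V q (Suc m))"
    unfolding V_star_def by auto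
  also have "\<dots> = V_star q"
    unfolding V_star_def using V_subset_Suc by blast
  finally show ?thesis .
qed

lemma V_subset_invariant:
  assumes "q ` {..<3} \<subseteq> T" "\<And>i x. i < 3 \<Longrightarrow> x \<in> T \<Longrightarrow> F q i x \<in> T"
  shows "V q m \<subseteq> T"
proof (induction m)
  case (Suc m)
  then show ?case using assms(2) by auto
qed (use assms in auto)

lemma V_star_subset_invariant:
  assumes "q ` {..<3} \<subseteq> T" "\<And>i x. i < 3 \<Longrightarrow> x \<in> T \<Longrightarrow> F q i x \<in> T"
  shows "V_star q \<subseteq> T"
  using V_subset_invariant [OF assms] unfolding V_star_def by blast

text \<open>A ball around 0 that contains the vertices is mapped into itself by every
  \<open>F q i\<close>, hence contains all points of all levels.\<close>

lemma compact_closure_V_star: "compact (closure (V_star q))"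
proof -
  define r where "r = Max (norm ` q ` {..<3})"
  have le: "norm (q i) \<le> r" if "i < 3" for i
    unfolding r_def using that by (intro Max_ge) auto
  have "V_star q \<subseteq> cball (0::real^2) r"
  proof (rule V_star_subset_invariant)
    fix i x assume "i < (3::nat)" "x \<in> cball (0::real^2) r"
    then have "norm (x + q i) \<le> r + r"
      by (intro norm_triangle_mono) (auto simp: le)
    then show "F q i x \<in> cball 0 r" by (simp add: F_def)
  qed (auto simp: le)
  then show ?thesis
    using bounded_cball bounded_subset compact_closure by blast
qed

lemma closure_V_star_fixed: "(\<Union>i<3. F q i ` closure (V_star q)) = closure (V_star q)"
proof -
  have "F q i ` closure (V_star q) = closure (F q i ` V_star q)" for i
  proof
    show "F q i ` closure (V_star q) \<subseteq> closure (F q i ` V_star q)"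
      by (intro image_closure_subset continuous_on_F closed_closure closure_subset)
    show "closure (F q i ` V_star q) \<subseteq> F q i ` closure (V_star q)"
      using compact_continuous_image [OF continuous_on_F compact_closure_V_star]
      by (intro closure_minimal image_mono closure_subset) (rule compact_imp_closed)
  qed
  then have "(\<Union>i<3. F q i ` closure (V_star q)) = closure (\<Union>i<3. F q i ` V_star q)"
    by (simp add: lessThan_3)
  then show ?thesis by (simp add: V_star_fixed)
qed

text \<open>Iterating \<open>F q i\<close> from any point of \<open>K\<close> converges to the fixed
  point \<open>q i\<close>; so \<open>K\<close> contains the vertices, and with them the closure of
  \<open>V_star q\<close>.\<close>

lemma attractor_unique:
  assumes ne: "K \<noteq> {}" and K: "compact K" and fixed: "K = (\<Union>i<3. F q i ` K)"
  shows "K = closure (V_star q)"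
proof
  have in_K: "F q i x \<in> K" if "i < 3" "x \<in> K" for i x
    using fixed that by blast
  have "q i \<in> K" if "i < 3" for i
  proof -
    obtain x where "x \<in> K" using ne by blast
    have mem: "(F q i ^^ k) x \<in> K" for k
      by (induction k) (auto simp: \<open>x \<in> K\<close> in_K that)
    have "dist ((F q i ^^ k) x) (q i) = (1/2)^k * dist x (q i)" for k
    proof (induction k)
      case (Suc k)
      then show ?case using dist_F [of q i "(F q i ^^ k) x" "q i"] by simp
    qed simp
    moreover have "(\<lambda>k. (1/2)^k * dist x (q i)) \<longlonglongrightarrow> 0 * dist x (q i)"
      by (intro tendsto_intros LIMSEQ_power_zero) auto
    ultimately have "(\<lambda>k. (F q i ^^ k) x) \<longlonglongrightarrow> q i"
      by (subst tendsto_dist_iff) simp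
    then show ?thesis
      by (intro Lim_in_closed_set [OF compact_imp_closed [OF K], of "\<lambda>k. (F q i ^^ k) x"])
        (auto simp: mem)
  qed
  then have "V_star q \<subseteq> K"
    by (intro V_star_subset_invariant in_K) auto
  then show "closure (V_star q) \<subseteq> K"
    by (simp add: K closure_minimal compact_imp_closed)
  \<comment> \<open>For the converse, take a point of \<open>K\<close> farthest from
    \<open>?S\<close>. It is the image of a point of \<open>K\<close> under some
    \<open>F q i\<close>, and such a map halves distances, so the largest distance is at most half
    of itself.\<close>
  let ?S = "closure (V_star q)"
  have S_ne: "?S \<noteq> {}" using vertex_in_V_star [of 0 q] by auto
  obtain x where x: "x \<in> K" and max: "\<And>y. y \<in> K \<Longrightarrow> infdist y ?S \<le> infdist x ?S"
    using continuous_attains_sup [OF K ne continuous_on_infdist [OF continuous_on_id], of ?S]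
    by auto
  obtain i y where y: "i < 3" "y \<in> K" "x = F q i y" using x fixed by blast
  obtain z where z: "z \<in> ?S" "infdist y ?S = dist y z"
    using infdist_attains_inf [OF closed_closure S_ne] by blast
  have "F q i z \<in> ?S" using closure_V_star_fixed y(1) z(1) by blast
  then have "infdist x ?S \<le> dist y z / 2"
    using infdist_le [of "F q i z" ?S x] by (simp add: y dist_F)
  also have "\<dots> \<le> infdist x ?S / 2" using max [OF y(2)] z by simp
  finally have "infdist x ?S \<le> 0" by simp
  then have "infdist y ?S = 0" if "y \<in> K" for y
    using max [OF that] infdist_nonneg [of y ?S] by linarith
  then show "K \<subseteq> ?S"
    using in_closed_iff_infdist_zero [OF closed_closure S_ne] by blast
qed

lemma SG_eq: "SG q = closure (V_star q)"
  unfolding SG_def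
proof (rule the_equality)
  show "closure (V_star q) \<noteq> {} \<and> compact (closure (V_star q)) \<and>
    closure (V_star q) = (\<Union>i<3. F q i ` closure (V_star q))"
    using compact_closure_V_star closure_V_star_fixed vertex_in_V_star [of 0 q] by auto
qed (use attractor_unique in blast)

lemma compact_SG: "compact (SG q)"
  unfolding SG_eq by (rule compact_closure_V_star)

lemma F_in_SG: "i < 3 \<Longrightarrow> x \<in> SG q \<Longrightarrow> F q i x \<in> SG q"
  using closure_V_star_fixed [of q] by (auto simp: SG_eq)

lemma SG_cases:
  assumes "x \<in> SG q"
  obtains i y where "i < 3" "y \<in> SG q" "x = F q i y"
  using assms closure_V_star_fixed [of q] unfolding SG_eq by blast

lemma V_subset_SG: "V q m \<subseteq> SG q"
  unfolding SG_eq V_star_def by (meson UNIV_I UN_upper closure_subset order_trans)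

lemma vertex_in_SG: "i < 3 \<Longrightarrow> q i \<in> SG q"
  using V_subset_SG [of q 0] by auto

subsection \<open>Barycentric coordinates\<close>

locale equilateral_triangle =
  fixes q :: "nat \<Rightarrow> real^2"
  assumes equi: "equilateral q"
begin

text \<open>For the centroid \<open>c\<close> and side length \<open>L\<close>, the inner products of the vectors
  \<open>q i - c\<close> are \<open>L\<^sup>2 / 3\<close> on and \<open>- L\<^sup>2 / 6\<close> off the diagonal; so the
  barycentric coordinates are scaled inner products.\<close>

definition bary :: "nat \<Rightarrow> real^2 \<Rightarrow> real" where
  "bary i x = 1/3 + 2 / (dist (q 0) (q 1))\<^sup>2 *
     ((x - (1/3) *\<^sub>R (q 0 + q 1 + q 2)) \<bullet> (q i - (1/3) *\<^sub>R (q 0 + q 1 + q 2)))"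

lemma bary_vertex:
  assumes "i < 3" "j < 3"
  shows "bary i (q j) = (if i = j then 1 else 0)"
proof -
  define L where "L = (dist (q 0) (q 1))\<^sup>2"
  define a where "a = q 1 - q 0"
  define b where "b = q 2 - q 0"
  have L: "L > 0" using equi by (auto simp: equilateral_def L_def)
  have 1: "a \<bullet> a = L" 
    by (simp add: a_def L_def dist_norm dot_square_norm norm_minus_commute)
  have 2: "b \<bullet> b = L" using equi
    by (simp add: b_def L_def dist_norm dot_square_norm norm_minus_commute equilateral_def)
  have "(a - b) \<bullet> (a - b) = L" using equi
    by (simp add: a_def b_def L_def dist_norm dot_square_norm norm_minus_commute equilateral_def)
  then have 3: "a \<bullet> b = L / 2" "b \<bullet> a = L/2"
    using 1 2 by (simp_all add: inner_diff inner_commute)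
  have q: "q 1 = q 0 + a" "q 2 = q 0 + b" by (simp_all add: a_def b_def)
  have c: "(1/3) *\<^sub>R (q 0 + q 1 + q 2) = q 0 + (1/3) *\<^sub>R a + (1/3) *\<^sub>R b"
    by (simp add: q vec_eq_iff)
  have v: "q 0 - (1/3) *\<^sub>R (q 0 + q 1 + q 2) = (-1/3) *\<^sub>R a + (-1/3) *\<^sub>R b"
    "q 1 - (1/3) *\<^sub>R (q 0 + q 1 + q 2) = (2/3) *\<^sub>R a + (-1/3) *\<^sub>R b"
    "q 2 - (1/3) *\<^sub>R (q 0 + q 1 + q 2) = (-1/3) *\<^sub>R a + (2/3) *\<^sub>R b"
    by (simp_all add: c) (simp_all add: q vec_eq_iff)
  have "(q j - (1/3) *\<^sub>R (q 0 + q 1 + q 2)) \<bullet> (q i - (1/3) *\<^sub>R (q 0 + q 1 + q 2))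
      = (if i = j then L/3 else - L/6)"
    using assms(1)
  proof (rule less_3_cases)
    show ?thesis if "i = 0"
      using assms(2) by (rule less_3_cases)
        (simp_all only: that v, simp_all add: inner_add_left inner_add_right inner_diff_left inner_diff_right 1 2 3)
    show ?thesis if "i = 1"
      using assms(2) by (rule less_3_cases)
        (simp_all only: that v, simp_all add: inner_add_left inner_add_right inner_diff_left inner_diff_right 1 2 3)
    show ?thesis if "i = 2"
      using assms(2) by (rule less_3_cases)
        (simp_all only: that v, simp_all add: inner_add_left inner_add_right inner_diff_left inner_diff_right 1 2 3)
  qed
  then show ?thesis
    unfolding bary_def L_def [symmetric] using L by simp
qed

lemma bary_F: "bary i (F q j x) = (bary i x + bary i (q j)) / 2"
proof -
  define c where "c = (1/3) *\<^sub>R (q 0 + q 1 + q 2)"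
  have *: "F q j x - c = (1/2) *\<^sub>R ((x - c) + (q j - c))"
    by (simp add: F_def vec_eq_iff)
  have 2: "(F q j x - c) \<bullet> w = ((x - c) \<bullet> w + (q j - c) \<bullet> w) / 2" for w
    unfolding * inner_scaleR_left inner_add_left by simp
  have "1/3 + k * ((s + t) / 2) = ((1/3 + k * s) + (1/3 + k * t)) / 2" for k s t :: real
    by (simp add: field_simps)
  then show ?thesis unfolding bary_def c_def [symmetric] 2 .
qed

lemma bary_F': "i < 3 \<Longrightarrow> j < 3 \<Longrightarrow> bary i (F q j x) = (bary i x + (if i = j then 1 else 0)) / 2"
  by (simp add: bary_F bary_vertex)

lemma continuous_on_bary [continuous_intros]: "continuous_on S (bary i)"
  unfolding bary_def by (intro continuous_intros)

text \<open>An induction principle for the gasket: closed properties pass from the vertices to all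
  points along the three maps.\<close>

lemma SG_subset_invariant:
  assumes "closed T" "q ` {..<3} \<subseteq> T" "\<And>i x. i < 3 \<Longrightarrow> x \<in> T \<Longrightarrow> F q i x \<in> T"
  shows "SG q \<subseteq> T"
  unfolding SG_eq by (intro closure_minimal V_star_subset_invariant assms)

lemma bary_nonneg:
  assumes "x \<in> SG q" "i < 3"
  shows "0 \<le> bary i x"
proof -
  have "SG q \<subseteq> {x. 0 \<le> bary i x}"
  proof (rule SG_subset_invariant)
    show "closed {x. 0 \<le> bary i x}"
      by (rule closed_Collect_le [OF continuous_on_const continuous_on_bary])
    show "q ` {..<3} \<subseteq> {x. 0 \<le> bary i x}"
      using assms(2) by (simp add: image_subset_iff bary_vertex)
    show "F q j x \<in> {x. 0 \<le> bary i x}" if "j < 3" "x \<in> {x. 0 \<le> bary i x}" for j x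
      using that assms(2) by (simp add: bary_F')
  qed
  then show ?thesis using assms(1) by blast
qed

lemma bary_sum:
  assumes "x \<in> SG q"
  shows "bary 0 x + bary 1 x + bary 2 x = 1"
proof -
  let ?T = "{x. bary 0 x + bary 1 x + bary 2 x = 1}"
  have "SG q \<subseteq> ?T"
  proof (rule SG_subset_invariant)
    show "closed ?T"
      by (rule closed_Collect_eq) (intro continuous_on_add continuous_on_bary continuous_on_const)+
    show "q ` {..<3} \<subseteq> ?T"
      by (simp add: lessThan_3 bary_vertex)
    show "F q j x \<in> ?T" if "j < 3" "x \<in> ?T" for j x
    proof -
      have "bary 0 x + bary 1 x + bary 2 x = 1" using that(2) by simp
      then show ?thesis
        using that(1) by (elim less_3_cases) (simp_all add: bary_F' field_simps)
    qed
  qed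
  then show ?thesis using assms(1) by blast
qed

lemma bary_eq:
  assumes "x \<in> SG q"
  shows "bary 0 x *\<^sub>R q 0 + bary 1 x *\<^sub>R q 1 + bary 2 x *\<^sub>R q 2 = x"
proof -
  define g where "g x = bary 0 x *\<^sub>R q 0 + bary 1 x *\<^sub>R q 1 + bary 2 x *\<^sub>R q 2" for x
  have "SG q \<subseteq> {x. g x = x}"
  proof (rule SG_subset_invariant)
    show "closed {x. g x = x}" unfolding g_def
      by (rule closed_Collect_eq)
        (intro continuous_on_add continuous_on_bary continuous_on_scaleR continuous_on_const
          continuous_on_id)+
    show "q ` {..<3} \<subseteq> {x. g x = x}"
      by (simp add: lessThan_3 bary_vertex g_def)
    show "F q j x \<in> {x. g x = x}" if "j < 3" "x \<in> {x. g x = x}" for j x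
    proof -
      have "g (F q j x) = (1/2) *\<^sub>R (g x + q j)"
        using that(1) unfolding g_def by (elim less_3_cases)
          (simp_all add: bary_F' scaleR_add_right scaleR_add_left add_divide_distrib)
      then show ?thesis using that(2) by (simp add: F_def)
    qed
  qed
  then show ?thesis using assms(1) unfolding g_def by blast
qed

text \<open>Two cells meet only in the midpoint of a side. Comparing the coordinates of index
  \<open>j\<close> gives \<open>bary j x = bary j y + 1\<close>, which is at least 1; as the
  coordinates of \<open>x\<close> are nonnegative with sum 1, \<open>x\<close> must be the vertex
  \<open>q j\<close>.\<close>

lemma F_eq_F_vertices:
  assumes ij: "i < 3" "j < 3" "i \<noteq> j" and xy: "x \<in> SG q" "y \<in> SG q" and eq: "F q i x = F q j y"
  shows "x = q j" "y = q i"
proof -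
  have *: "x = q j" if ij: "i < 3" "j < 3" "i \<noteq> j" and xy: "x \<in> SG q" "y \<in> SG q"
    and eq: "F q i x = F q j y" for i j x y
  proof -
    have "(bary j x) / 2 = (bary j y + 1) / 2"
      using ij arg_cong [OF eq, of "bary j"] by (simp add: bary_F')
    then have 1: "bary j x \<ge> 1" using bary_nonneg [OF xy(2), of j] ij by simp
    have "bary k x = (if k = j then 1 else 0)" if "k < 3" for k
      using that ij(2) by (elim less_3_cases)
        (use 1 bary_sum [OF xy(1)] bary_nonneg [OF xy(1), of 0]
          bary_nonneg [OF xy(1), of 1] bary_nonneg [OF xy(1), of 2] in auto)
    then have "x = (if 0 = j then 1 else 0) *\<^sub>R q 0 + (if 1 = j then 1 else 0) *\<^sub>R q 1
        + (if 2 = j then 1 else 0) *\<^sub>R q 2"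
      using bary_eq [OF xy(1)] by simp
    then show ?thesis
      using ij(2) by (elim less_3_cases) auto
  qed
  show "x = q j" by (rule *) fact+
  show "y = q i" by (rule * [of j i y x]) (use assms in auto)
qed

end

subsection \<open>Self-similarity of the energy\<close>

context equilateral_triangle
begin

lemma q_eq_iff: "i < 3 \<Longrightarrow> j < 3 \<Longrightarrow> q i = q j \<longleftrightarrow> i = j"
  by (metis bary_vertex zero_neq_one)

lemma words_Suc: "words (Suc m) = (\<Union>i<3. (#) i ` words m)"
  by (auto simp: words_def length_Suc_conv)

lemma adj_Suc:
  "adj q (Suc m) x y \<longleftrightarrow> (\<exists>i<3. \<exists>x' y'. x = F q i x' \<and> y = F q i y' \<and> adj q m x' y')"
  (is "?L \<longleftrightarrow> ?R")
proof
  assume ?L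
  then show ?R by (auto simp: adj_def words_Suc) fastforce+
next
  assume ?R
  then show ?L unfolding adj_def words_Suc by fastforce
qed

lemma adj_V: "adj q m x y \<Longrightarrow> x \<in> V q m \<and> y \<in> V q m"
proof (induction m arbitrary: x y)
  case 0
  then show ?case by (auto simp: adj_def words_def)
next
  case (Suc m)
  then show ?case by (fastforce simp: adj_Suc)
qed

lemma finite_adj: "finite {(x, y). adj q m x y}"
  by (rule finite_subset [of _ "V q m \<times> V q m"]) (auto simp: finite_V dest: adj_V)

lemma adj_Suc_pairs:
  "{(x, y). adj q (Suc m) x y} = (\<Union>i<3. map_prod (F q i) (F q i) ` {(x, y). adj q m x y})"
  by (auto simp: adj_Suc image_iff)

text \<open>The edges of the next level are the images of the present ones under the three maps. No
  edge arises from two maps, since two cells share at most one point and an edge has two distinct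
  ends.\<close>

lemma graph_energy_Suc:
  "graph_energy q (Suc m) u = 5/3 * (\<Sum>i<3. graph_energy q m (u \<circ> F q i))"
proof -
  let ?E = "{(x, y). adj q m x y}"
  have disj: "map_prod (F q i) (F q i) ` ?E \<inter> map_prod (F q j) (F q j) ` ?E = {}"
    if ij: "i < 3" "j < 3" "i \<noteq> j" for i j
  proof -
    have False if "adj q m x y" "adj q m x' y'" "F q i x = F q j x'" "F q i y = F q j y'" for x y x' y'
    proof -
      have "x \<in> SG q" "y \<in> SG q" "x' \<in> SG q" "y' \<in> SG q"
        using that(1,2) adj_V V_subset_SG by blast+
      then have "x = q j" "y = q j"
        using F_eq_F_vertices(1) [OF ij] that(3,4) by blast+
      then show False using that(1) by (simp add: adj_def)
    qed
    then show ?thesis by fastforce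
  qed
  have "(\<Sum>(x, y)\<in>{(x, y). adj q (Suc m) x y}. (u x - u y)^2)
      = (\<Sum>i<3. \<Sum>(x, y)\<in>map_prod (F q i) (F q i) ` ?E. (u x - u y)^2)"
    unfolding adj_Suc_pairs
    by (rule sum.UNION_disjoint) (auto intro: finite_imageI finite_adj simp del: disjoint_iff simp: disj)
  also have "\<dots> = (\<Sum>i<3. \<Sum>(x, y)\<in>?E. ((u \<circ> F q i) x - (u \<circ> F q i) y)^2)"
  proof (rule sum.cong [OF refl])
    fix i
    have "inj_on (map_prod (F q i) (F q i)) ?E"
      by (auto intro!: inj_onI)
    then show "(\<Sum>(x, y)\<in>map_prod (F q i) (F q i) ` ?E. (u x - u y)^2)
        = (\<Sum>(x, y)\<in>?E. ((u \<circ> F q i) x - (u \<circ> F q i) y)^2)"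
      by (simp add: sum.reindex case_prod_unfold)
  qed
  finally show ?thesis
    by (simp add: graph_energy_def lessThan_3 field_simps)
qed

lemma graph_energy_0:
  "graph_energy q 0 u = (u (q 0) - u (q 1))^2 + (u (q 1) - u (q 2))^2 + (u (q 2) - u (q 0))^2"
proof -
  have ne: "q 0 \<noteq> q 1" "q 0 \<noteq> q 2" "q 1 \<noteq> q 2" "q 1 \<noteq> q 0" "q 2 \<noteq> q 0" "q 2 \<noteq> q 1"
    using q_eq_iff [of 0 1] q_eq_iff [of 0 2] q_eq_iff [of 1 2] by auto
  have "{(x, y). adj q 0 x y}
      = {(q 0, q 1), (q 1, q 0), (q 1, q 2), (q 2, q 1), (q 2, q 0), (q 0, q 2)}"
    using ne by (auto simp: adj_def words_def lessThan_3)
  then show ?thesis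
    using ne by (simp add: graph_energy_def power2_commute)
qed

text \<open>With \<open>x\<close>, \<open>y\<close>, \<open>z\<close> the deviations from the harmonic values at the midpoints, the cross terms
  cancel.\<close>

lemma harmonic_minimum:
  fixes a b c r s t :: real
  shows "(a - b)^2 + (b - c)^2 + (c - a)^2 \<le> 5/3 * (((a - t)^2 + (t - s)^2 + (s - a)^2)
    + ((t - b)^2 + (b - r)^2 + (r - t)^2) + ((s - r)^2 + (r - c)^2 + (c - s)^2))"
proof -
  define x where "x = r - (a + 2*b + 2*c) / 5"
  define y where "y = s - (2*a + b + 2*c) / 5"
  define z where "z = t - (2*a + 2*b + c) / 5"
  have rst: "r = x + (a + 2*b + 2*c) / 5" "s = y + (2*a + b + 2*c) / 5" "t = z + (2*a + 2*b + c) / 5"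
    by (simp_all add: x_def y_def z_def)
  have "5/3 * (((a - t)^2 + (t - s)^2 + (s - a)^2)
    + ((t - b)^2 + (b - r)^2 + (r - t)^2) + ((s - r)^2 + (r - c)^2 + (c - s)^2))
    = (a - b)^2 + (b - c)^2 + (c - a)^2
      + 5/3 * (2 * (x^2 + y^2 + z^2) + (x - y)^2 + (y - z)^2 + (z - x)^2)"
    unfolding rst by (simp add: power2_eq_square field_simps)
  then show ?thesis by simp
qed

text \<open>\<open>harmonic_minimum\<close> treats a single cell; self-similarity carries the
  inequality to all levels.\<close>

lemma graph_energy_le_Suc: "graph_energy q m u \<le> graph_energy q (Suc m) u"
proof (induction m arbitrary: u)
  case 0
  show ?case
    using harmonic_minimum [of "u (q 0)" "u (q 1)" "u (q 2)" "u (F q 0 (q 1))" "u (F q 0 (q 2))"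
        "u (F q 1 (q 2))"]
    by (simp add: graph_energy_Suc graph_energy_0 lessThan_3 F_swap [of q 1 0] F_swap [of q 2 0]
        F_swap [of q 2 1] power2_commute add_ac)
next
  case (Suc m)
  show ?case
    unfolding graph_energy_Suc [of "Suc m" u] graph_energy_Suc [of m u]
    by (intro mult_left_mono sum_mono Suc.IH) simp
qed

lemma energy_eq_SUP: "energy q u = (SUP m. ereal (graph_energy q m u))"
  unfolding energy_def
  by (intro limI LIMSEQ_SUP incseq_SucI) (simp add: graph_energy_le_Suc)

lemma graph_energy_le_energy: "ereal (graph_energy q m u) \<le> energy q u"
  unfolding energy_eq_SUP by (rule SUP_upper) simp

text \<open>All minimizers constructed below have constant graph energy from some level on, which
  spares any genuine passage to the limit.\<close>

lemma energy_eqI: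
  assumes "\<And>m. m \<ge> k \<Longrightarrow> graph_energy q m u = c"
  shows "energy q u = ereal c"
proof -
  have "(\<lambda>m. ereal (graph_energy q m u)) \<longlonglongrightarrow> ereal c"
    by (rule tendsto_eventually, rule eventually_mono [OF eventually_ge_at_top [of k]]) (simp add: assms)
  then show ?thesis unfolding energy_def by (rule limI)
qed

end

subsection \<open>Harmonic functions\<close>

context equilateral_triangle
begin

section \<open>Gluing functions given on the three cells\<close>

definition paste :: "(nat \<Rightarrow> real^2 \<Rightarrow> real) \<Rightarrow> real^2 \<Rightarrow> real" where
  "paste g x = (let i = SOME i. i < 3 \<and> x \<in> F q i ` SG q in g i (F_inv q i x))"

text \<open>The hypothesis \<open>compat\<close> says that the pieces agree where two cells meet, so
  it does not matter which cell \<open>SOME\<close> picks.\<close>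

lemma paste_F:
  assumes compat: "\<And>i j. i < 3 \<Longrightarrow> j < 3 \<Longrightarrow> g i (q j) = g j (q i)"
    and x: "x \<in> SG q" and i: "i < 3"
  shows "paste g (F q i x) = g i x"
proof -
  define k where "k = (SOME k. k < 3 \<and> F q i x \<in> F q k ` SG q)"
  have "k < 3 \<and> F q i x \<in> F q k ` SG q"
    unfolding k_def by (rule someI [of _ i]) (use x i in auto)
  then obtain y where k: "k < 3" and y: "y \<in> SG q" "F q i x = F q k y" by auto
  have "paste g (F q i x) = g k y"
    unfolding paste_def k_def [symmetric] Let_def by (simp add: y)
  also have "\<dots> = g i x"
  proof (cases "i = k")
    case True
    then show ?thesis using y by simp
  next
    case False
    then show ?thesis using F_eq_F_vertices [OF i k False x y] compat i k by simp
  qed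
  finally show ?thesis .
qed

lemma continuous_on_paste:
  assumes compat: "\<And>i j. i < 3 \<Longrightarrow> j < 3 \<Longrightarrow> g i (q j) = g j (q i)"
    and cont: "\<And>i. i < 3 \<Longrightarrow> continuous_on (SG q) (g i)"
  shows "continuous_on (SG q) (paste g)"
proof -
  have "continuous_on (\<Union>i\<in>{..<3}. F q i ` SG q) (paste g)"
  proof (rule continuous_on_closed_Union)
    fix i :: nat assume i: "i \<in> {..<3}"
    show "closed (F q i ` SG q)"
      by (intro compact_imp_closed compact_continuous_image continuous_on_F compact_SG)
    have cont_i: "continuous_on (F q i ` SG q) (\<lambda>x. g i (F_inv q i x))"
    proof (rule continuous_on_compose2 [OF cont])
      show "continuous_on (F q i ` SG q) (F_inv q i)"
        unfolding F_inv_def by (intro continuous_intros)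
    qed (use i in auto)
    have "paste g (F q i x) = g i x" if "x \<in> SG q" for x
      by (rule paste_F, rule compat) (use i that in auto)
    then show "continuous_on (F q i ` SG q) (paste g)"
      by (intro continuous_on_eq [OF cont_i]) auto
  qed simp
  also have "(\<Union>i\<in>{..<3}. F q i ` SG q) = SG q"
    unfolding SG_eq by (rule closure_V_star_fixed)
  finally show ?thesis .
qed

lemma graph_energy_cong:
  assumes "\<And>x. x \<in> SG q \<Longrightarrow> u x = v x"
  shows "graph_energy q m u = graph_energy q m v"
proof -
  have "(\<Sum>(x, y)\<in>{(x, y). adj q m x y}. (u x - u y)^2)
      = (\<Sum>(x, y)\<in>{(x, y). adj q m x y}. (v x - v y)^2)"
  proof (rule sum.cong [OF refl], clarify)
    fix x y assume "adj q m x y"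
    then have "x \<in> SG q" "y \<in> SG q" using adj_V V_subset_SG by blast+
    then show "(u x - u y)^2 = (v x - v y)^2" by (simp add: assms)
  qed
  then show ?thesis by (simp add: graph_energy_def)
qed

section \<open>Harmonic functions as uniform limits of piecewise affine ones\<close>

text \<open>This is the 1/5-2/5 rule: a midpoint gets 2/5 of the value at each end of its side and
  1/5 of the value at the opposite vertex. The result lists the vertex values of the harmonic
  function composed with \<open>F q i\<close>.\<close>

definition harm_restrict :: "nat \<Rightarrow> (nat \<Rightarrow> real) \<Rightarrow> nat \<Rightarrow> real" where
  "harm_restrict i a j = (if j = i then a i else (a 0 + a 1 + a 2 + a i + a j) / 5)"

lemma harm_restrict_swap: "harm_restrict i a j = harm_restrict j a i"
  by (simp add: harm_restrict_def)

lemma harm_restrict_same [simp]: "harm_restrict i a i = a i"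
  by (simp add: harm_restrict_def)

text \<open>On the gasket, the approximant of index \<open>k\<close> takes the harmonic values on
  \<open>V q k\<close> and is affine in the barycentric coordinates on each cell of level
  \<open>k\<close>.\<close>

primrec harm_approx :: "nat \<Rightarrow> (nat \<Rightarrow> real) \<Rightarrow> real^2 \<Rightarrow> real" where
  "harm_approx 0 a = (\<lambda>x. a 0 * bary 0 x + a 1 * bary 1 x + a 2 * bary 2 x)"
| "harm_approx (Suc k) a = paste (\<lambda>i. harm_approx k (harm_restrict i a))"

lemma harm_approx_vertex: "j < 3 \<Longrightarrow> harm_approx k a (q j) = a j"
proof (induction k arbitrary: a j)
  case 0
  then show ?case by (elim less_3_cases) (simp_all add: bary_vertex)
next
  case (Suc k)
  have "harm_approx (Suc k) a (F q j (q j)) = harm_approx k (harm_restrict j a) (q j)"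
    unfolding harm_approx.simps(2)
    by (rule paste_F) (use Suc in \<open>simp_all add: vertex_in_SG harm_restrict_swap\<close>)
  then show ?case by (simp add: Suc del: harm_approx.simps)
qed

lemma harm_approx_Suc_F:
  assumes "i < 3" "x \<in> SG q"
  shows "harm_approx (Suc k) a (F q i x) = harm_approx k (harm_restrict i a) x"
  unfolding harm_approx.simps(2)
  by (rule paste_F) (use assms in \<open>simp_all add: harm_approx_vertex harm_restrict_swap\<close>)

lemma continuous_on_harm_approx: "continuous_on (SG q) (harm_approx k a)"
proof (induction k arbitrary: a)
  case 0
  show ?case unfolding harm_approx.simps(1) by (intro continuous_intros)
next
  case (Suc k)
  show ?case unfolding harm_approx.simps(2)
    by (rule continuous_on_paste) (simp_all add: Suc harm_approx_vertex harm_restrict_swap)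
qed

definition osc :: "(nat \<Rightarrow> real) \<Rightarrow> real" where
  "osc a = \<bar>a 0 - a 1\<bar> + \<bar>a 1 - a 2\<bar> + \<bar>a 2 - a 0\<bar>"

lemma osc_nonneg: "0 \<le> osc a"
  by (simp add: osc_def)

text \<open>This contraction is what makes the approximants converge geometrically.\<close>

lemma osc_harm_restrict: "i < 3 \<Longrightarrow> osc (harm_restrict i a) \<le> 3/5 * osc a"
  by (elim less_3_cases) (simp_all add: osc_def harm_restrict_def, argo+)

lemma harm_approx_0_bound:
  assumes "i < 3" "x \<in> SG q"
  shows "\<bar>harm_approx 0 a x - a i\<bar> \<le> osc a"
proof -
  note b = bary_nonneg [OF assms(2), of 0] bary_nonneg [OF assms(2), of 1]
    bary_nonneg [OF assms(2), of 2] bary_sum [OF assms(2)]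
  have "harm_approx 0 a x - a i
      = harm_approx 0 a x - (bary 0 x + bary 1 x + bary 2 x) * a i"
    by (simp add: b)
  also have "\<dots> = (a 0 - a i) * bary 0 x + (a 1 - a i) * bary 1 x + (a 2 - a i) * bary 2 x"
    by (simp add: algebra_simps)
  also have "\<bar>\<dots>\<bar> \<le> \<bar>a 0 - a i\<bar> * bary 0 x + \<bar>a 1 - a i\<bar> * bary 1 x + \<bar>a 2 - a i\<bar> * bary 2 x"
    using b by (intro order_trans [OF abs_triangle_ineq] add_mono) (simp_all add: abs_mult)
  also have "\<dots> \<le> osc a * bary 0 x + osc a * bary 1 x + osc a * bary 2 x"
    using assms(1) b
    by (intro add_mono mult_right_mono) (auto simp: osc_def elim!: less_3_cases)
  also have "\<dots> = osc a * (bary 0 x + bary 1 x + bary 2 x)"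
    by (simp add: algebra_simps)
  also have "\<dots> = osc a" by (simp add: b)
  finally show ?thesis .
qed

text \<open>On the cell of index \<open>i\<close> the first two approximants both stay within
  \<open>osc a\<close> of \<open>a i\<close>, whence the factor 2. Passing to a cell lowers the
  level by one and shrinks the oscillation by 3/5.\<close>

lemma harm_approx_diff:
  assumes "x \<in> SG q"
  shows "\<bar>harm_approx (Suc k) a x - harm_approx k a x\<bar> \<le> (3/5)^k * (2 * osc a)"
  using assms
proof (induction k arbitrary: a x)
  case 0
  obtain i y where i: "i < 3" and y: "y \<in> SG q" "x = F q i y"
    using 0 by (rule SG_cases)
  have "\<bar>harm_approx 0 (harm_restrict i a) y - a i\<bar> \<le> osc a"
    using harm_approx_0_bound [OF i y(1), of "harm_restrict i a"] osc_harm_restrict [OF i, of a]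
      osc_nonneg [of a] unfolding harm_restrict_same by linarith
  moreover have "\<bar>harm_approx 0 a x - a i\<bar> \<le> osc a"
    by (rule harm_approx_0_bound) fact+
  ultimately show ?case
    using harm_approx_Suc_F [OF i y(1), of 0 a, folded y(2)]
    by (simp del: harm_approx.simps)
next
  case (Suc k)
  obtain i y where i: "i < 3" and y: "y \<in> SG q" "x = F q i y"
    using Suc.prems by (rule SG_cases)
  have "\<bar>harm_approx (Suc (Suc k)) a x - harm_approx (Suc k) a x\<bar>
      \<le> (3/5)^k * (2 * osc (harm_restrict i a))"
    unfolding y(2) harm_approx_Suc_F [OF i y(1)] by (rule Suc.IH) fact
  also have "\<dots> \<le> (3/5)^k * (2 * (3/5 * osc a))"
    using osc_harm_restrict [OF i, of a] by (intro mult_left_mono) auto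
  finally show ?case by simp
qed

definition harm :: "(nat \<Rightarrow> real) \<Rightarrow> real^2 \<Rightarrow> real" where
  "harm a x = lim (\<lambda>k. harm_approx k a x)"

lemma uniform_limit_harm: "uniform_limit (SG q) (\<lambda>k. harm_approx k a) (harm a) sequentially"
proof -
  define D where "D k x = harm_approx (Suc k) a x - harm_approx k a x" for k x
  have "uniform_limit (SG q) (\<lambda>n x. \<Sum>k<n. D k x) (\<lambda>x. suminf (\<lambda>k. D k x)) sequentially"
  proof (rule Weierstrass_m_test)
    show "norm (D k x) \<le> (3/5)^k * (2 * osc a)" if "x \<in> SG q" for k x
      using harm_approx_diff [OF that, of k a] by (simp add: D_def)
    show "summable (\<lambda>k. (3/5)^k * (2 * osc a))"
      by (intro summable_mult2 summable_geometric) simp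
  qed
  moreover have "(\<Sum>k<n. D k x) = harm_approx n a x - harm_approx 0 a x" for n x
    unfolding D_def by (rule sum_lessThan_telescope)
  ultimately have "uniform_limit (SG q) (\<lambda>n x. harm_approx n a x - harm_approx 0 a x)
      (\<lambda>x. suminf (\<lambda>k. D k x)) sequentially" by simp
  from uniform_limit_add [OF this uniform_limit_const [of "harm_approx 0 a"]]
  have lim: "uniform_limit (SG q) (\<lambda>n. harm_approx n a)
      (\<lambda>x. suminf (\<lambda>k. D k x) + harm_approx 0 a x) sequentially"
    by simp
  have "harm a x = suminf (\<lambda>k. D k x) + harm_approx 0 a x" if "x \<in> SG q" for x
    unfolding harm_def using tendsto_uniform_limitI [OF lim that] by (rule limI)
  then show ?thesis
    using lim by (subst uniform_limit_cong' [where g = "\<lambda>n. harm_approx n a"]) auto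
qed

lemma harm_approx_tendsto: "x \<in> SG q \<Longrightarrow> (\<lambda>k. harm_approx k a x) \<longlonglongrightarrow> harm a x"
  by (rule tendsto_uniform_limitI [OF uniform_limit_harm])

lemma continuous_on_harm: "continuous_on (SG q) (harm a)"
  by (rule uniform_limit_theorem [OF _ uniform_limit_harm])
    (simp_all add: continuous_on_harm_approx)

lemma harm_vertex: "j < 3 \<Longrightarrow> harm a (q j) = a j"
  by (simp add: harm_def harm_approx_vertex)

lemma harm_F:
  assumes "i < 3" "x \<in> SG q"
  shows "harm a (F q i x) = harm (harm_restrict i a) x"
proof -
  have "(\<lambda>k. harm_approx (Suc k) a (F q i x)) \<longlonglongrightarrow> harm a (F q i x)"
    by (rule LIMSEQ_Suc [OF harm_approx_tendsto]) (simp add: F_in_SG assms)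
  then have "(\<lambda>k. harm_approx k (harm_restrict i a) x) \<longlonglongrightarrow> harm a (F q i x)"
    unfolding harm_approx_Suc_F [OF assms] .
  then show ?thesis
    using harm_approx_tendsto [OF assms(2)] by (rule LIMSEQ_unique)
qed

text \<open>By the 1/5-2/5 rule the energies of the three restrictions add up to 3/5 of the energy
  on the vertices, and the factor 5/3 restores it.\<close>

lemma graph_energy_harm:
  "graph_energy q m (harm a) = (a 0 - a 1)^2 + (a 1 - a 2)^2 + (a 2 - a 0)^2"
proof (induction m arbitrary: a)
  case 0
  show ?case by (simp add: graph_energy_0 harm_vertex)
next
  case (Suc m)
  have "graph_energy q m (harm a \<circ> F q i) = graph_energy q m (harm (harm_restrict i a))"
    if "i < 3" for i
    by (rule graph_energy_cong) (simp add: harm_F that)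
  then have "graph_energy q (Suc m) (harm a) = 5/3 * (\<Sum>i<3. graph_energy q m (harm (harm_restrict i a)))"
    by (simp add: graph_energy_Suc)
  also have "\<dots> = (a 0 - a 1)^2 + (a 1 - a 2)^2 + (a 2 - a 0)^2"
    unfolding Suc by (simp add: lessThan_3 harm_restrict_def power2_eq_square field_simps)
  finally show ?case .
qed

end

subsection \<open>Minimal energy with prescribed values on the bottom row and the top\<close>

context equilateral_triangle
begin

section \<open>The bottom row and its two halves\<close>

abbreviation row :: "nat \<Rightarrow> (real^2) set" where
  "row n \<equiv> bottom_pt q n ` {0..2^n}"

lemma bottom_pt_0 [simp]: "bottom_pt q n 0 = q 1"
  by (simp add: bottom_pt_def)

lemma bottom_pt_end [simp]: "bottom_pt q n (2^n) = q 2"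
  by (simp add: bottom_pt_def)

lemma F_1_bottom_pt: "F q 1 (bottom_pt q n i) = bottom_pt q (Suc n) i"
  by (simp add: F_def bottom_pt_def vec_eq_iff field_simps)

lemma F_2_bottom_pt: "F q 2 (bottom_pt q n i) = bottom_pt q (Suc n) (2^n + i)"
  by (simp add: F_def bottom_pt_def vec_eq_iff field_simps)

lemma bottom_pt_eq_iff: "bottom_pt q n i = bottom_pt q n j \<longleftrightarrow> i = j"
  using q_eq_iff [of 2 1] by (simp add: bottom_pt_def)

lemma row_Suc: "row (Suc n) = F q 1 ` row n \<union> F q 2 ` row n"
proof -
  have "{0..2^Suc n} = {0..2^n} \<union> (+) (2^n) ` {0..2^n::nat}"
    by (auto simp: image_iff)
  then show ?thesis
    by (simp only: image_Un image_image F_1_bottom_pt F_2_bottom_pt)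
qed

lemma row_0: "row 0 = {q 1, q 2}"
proof -
  have "{0..1::nat} = {0, 1}" by auto
  then show ?thesis using bottom_pt_end [of 0] by simp
qed

lemma ends_in_row: "q 1 \<in> row n" "q 2 \<in> row n"
  using bottom_pt_0 [of n] bottom_pt_end [of n] by (metis atLeastAtMost_iff image_eqI le_refl zero_le)+

lemma row_SG: "row n \<subseteq> SG q"
proof (induction n)
  case 0
  show ?case unfolding row_0 by (simp add: vertex_in_SG)
next
  case (Suc n)
  then show ?case unfolding row_Suc using F_in_SG by auto
qed

text \<open>It serves to keep the top apart from the row, since \<open>bary 0\<close> is 1 at
  \<open>q 0\<close>.\<close>

lemma bary_0_row: "x \<in> row n \<Longrightarrow> bary 0 x = 0"
proof (induction n arbitrary: x)
  case 0
  then show ?case unfolding row_0 by (auto simp: bary_vertex)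
next
  case (Suc n)
  then show ?case unfolding row_Suc by (auto simp: bary_F')
qed

lemma q_0_notin_row: "q 0 \<notin> row n"
  using bary_0_row [of "q 0" n] bary_vertex [of 0 0] by auto

section \<open>The least energy for given values on the row and the top\<close>

text \<open>Summing over the edges of the row instead of its points gives half weight to the ends,
  and makes the sum split evenly at the midpoint.\<close>

definition mean :: "nat \<Rightarrow> (real^2 \<Rightarrow> real) \<Rightarrow> real" where
  "mean n u = (\<Sum>i<2^n. u (bottom_pt q n i) + u (bottom_pt q n (Suc i))) / 2 ^ Suc n"

lemma mean_0: "mean 0 u = (u (q 1) + u (q 2)) / 2"
  using bottom_pt_end [of 0] by (simp add: mean_def lessThan_Suc flip: One_nat_def)

lemma sum_lessThan_add: "(\<Sum>i<a + b. f i) = (\<Sum>i<a. f i) + (\<Sum>i<b. f (a + i))"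
  for f :: "nat \<Rightarrow> real"
  by (induction b) simp_all

lemma mean_Suc: "mean (Suc n) u = (mean n (u \<circ> F q 1) + mean n (u \<circ> F q 2)) / 2"
proof -
  have "(2::nat) ^ Suc n = 2^n + 2^n" by simp
  then show ?thesis
    unfolding mean_def by (simp only: sum_lessThan_add o_def F_1_bottom_pt F_2_bottom_pt)
      (simp add: field_simps)
qed

lemma mean_cong: "(\<And>x. x \<in> row n \<Longrightarrow> u x = v x) \<Longrightarrow> mean n u = mean n v"
  unfolding mean_def by (intro arg_cong2 [where f = "(/)"] sum.cong arg_cong2 [where f = "(+)"]) auto

text \<open>This is the effective conductance between the top and the row when the whole row is held
  at one value; at level 0 it consists of two unit edges in parallel.\<close>

primrec top_cond :: "nat \<Rightarrow> real" where
  "top_cond 0 = 2"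
| "top_cond (Suc n) = 10/3 * top_cond n / (1 + top_cond n)"

lemma top_cond_pos: "0 < top_cond n"
  by (induction n) (simp_all add: add_pos_pos)

text \<open>At level 0, the bottom edge contributes 1, and the two upper edges contribute 1/2 beyond
  their part in \<open>top_cond\<close>. In the recursion, the coefficient of the squared difference
  of means is the series combination of 3/2 and \<open>top_cond n / 2\<close>.\<close>

primrec row_energy :: "nat \<Rightarrow> (real^2 \<Rightarrow> real) \<Rightarrow> real" where
  "row_energy 0 u = 3/2 * (u (q 1) - u (q 2))^2"
| "row_energy (Suc n) u = 5/3 * (row_energy n (u \<circ> F q 1) + row_energy n (u \<circ> F q 2)
    + 3 * top_cond n / (2 * (3 + top_cond n)) * (mean n (u \<circ> F q 1) - mean n (u \<circ> F q 2))^2)"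

definition min_energy :: "nat \<Rightarrow> (real^2 \<Rightarrow> real) \<Rightarrow> real" where
  "min_energy n u = top_cond n * (u (q 0) - mean n u)^2 + row_energy n u"

lemma row_energy_cong: "(\<And>x. x \<in> row n \<Longrightarrow> u x = v x) \<Longrightarrow> row_energy n u = row_energy n v"
proof (induction n arbitrary: u v)
  case 0
  then show ?case unfolding row_0 by simp
next
  case (Suc n)
  have "(u \<circ> F q i) x = (v \<circ> F q i) x" if "i = 1 \<or> i = 2" "x \<in> row n" for i x
    using that Suc.prems unfolding row_Suc by auto
  then have "row_energy n (u \<circ> F q i) = row_energy n (v \<circ> F q i)"
    "mean n (u \<circ> F q i) = mean n (v \<circ> F q i)" if "i = 1 \<or> i = 2" for i
    using that by (blast intro: Suc.IH mean_cong)+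
  then show ?case by simp
qed

text \<open>The law for two conductances in series: the first term is the minimum over
  \<open>x\<close>, the second is the excess.\<close>

lemma complete_square:
  fixes x y \<alpha> \<beta> :: real
  assumes "\<alpha> + \<beta> \<noteq> 0"
  shows "\<alpha> * x^2 + \<beta> * (x - y)^2
    = \<alpha> * \<beta> / (\<alpha> + \<beta>) * y^2 + (\<alpha> + \<beta>) * (x - \<beta> * y / (\<alpha> + \<beta>))^2"
proof -
  define s where "s = \<alpha> + \<beta>"
  have \<alpha>: "\<alpha> = s - \<beta>" and s: "s \<noteq> 0" using assms by (simp_all add: s_def)
  show ?thesis
    unfolding s_def [symmetric] unfolding \<alpha> using s by (simp add: power2_eq_square field_simps)
qed

text \<open>Separate the mean and the difference of \<open>r\<close> and \<open>s\<close>, and complete the square in each.\<close>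

lemma min_energy_step:
  fixes a r s x y d :: real
  assumes d: "0 < d"
  shows "5/3 * ((a - r)^2 + (r - s)^2 + (s - a)^2 + d * (r - x)^2 + d * (s - y)^2)
    = 10/3 * d / (1 + d) * (a - (x + y) / 2)^2 + 5/3 * (3 * d / (2 * (3 + d)) * (x - y)^2)
      + 5/3 * (2 * (1 + d) * ((r + s) / 2 - a - d * ((x + y) / 2 - a) / (1 + d))^2
        + (3 + d) / 2 * (r - s - d * (x - y) / (3 + d))^2)"
proof -
  have e1: "2 * ((r + s) / 2 - a)^2 + 2 * d * ((r + s) / 2 - a - ((x + y) / 2 - a))^2
    = 2 * d / (1 + d) * (a - (x + y) / 2)^2
      + 2 * (1 + d) * ((r + s) / 2 - a - d * ((x + y) / 2 - a) / (1 + d))^2"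
  proof -
    have [simp]: "4 * d * z / (2 + 2 * d) = 2 * d * z / (1 + d)"
      "2 * d * z / (2 + 2 * d) = d * z / (1 + d)" for z
      using d by (simp_all add: divide_simps)
    show ?thesis
      using complete_square [of 2 "2 * d" "(r + s) / 2 - a" "(x + y) / 2 - a"] d
      by (simp add: power2_commute [of a])
  qed
  have e2: "3/2 * (r - s)^2 + d/2 * (r - s - (x - y))^2
    = 3 * d / (2 * (3 + d)) * (x - y)^2 + (3 + d) / 2 * (r - s - d * (x - y) / (3 + d))^2"
  proof -
    have [simp]: "3/2 * (d/2) / (3/2 + d/2) = 3 * d / (2 * (3 + d))"
      "d/2 * z / (3/2 + d/2) = d * z / (3 + d)" "3/2 + d/2 = (3 + d) / 2" for z
      using d by (simp_all add: divide_simps)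
    show ?thesis
      using complete_square [of "3/2" "d/2" "r - s" "x - y"] d by simp
  qed
  have e3: "(a - r)^2 + (r - s)^2 + (s - a)^2 + d * (r - x)^2 + d * (s - y)^2
    = (2 * ((r + s) / 2 - a)^2 + 2 * d * ((r + s) / 2 - a - ((x + y) / 2 - a))^2)
      + (3/2 * (r - s)^2 + d/2 * (r - s - (x - y))^2)"
    by (simp add: power2_eq_square field_simps)
  have e4: "10/3 * d / (1 + d) * z = 5/3 * (2 * d / (1 + d) * z)" for z by simp
  show ?thesis unfolding e4 e3 e1 e2 by (simp only: distrib_left add_ac)
qed

lemma min_energy_0: "min_energy 0 u = graph_energy q 0 u"
  by (simp add: min_energy_def mean_0 graph_energy_0 power2_eq_square field_simps)

lemma graph_energy_mono: "m \<le> k \<Longrightarrow> graph_energy q m u \<le> graph_energy q k u"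
  by (rule lift_Suc_mono_le [of "\<lambda>m. graph_energy q m u", OF graph_energy_le_Suc])

text \<open>The upper cell is bounded below by its energy at level 0, the lower cells by induction.
  In \<open>min_energy_step\<close> the squares that involve the midpoint values \<open>?r\<close>
  and \<open>?s\<close> are nonnegative and are dropped.\<close>

lemma min_energy_le_graph_energy: "n \<le> m \<Longrightarrow> min_energy n u \<le> graph_energy q m u"
proof (induction n arbitrary: m u)
  case 0
  then show ?case by (simp add: min_energy_0 graph_energy_mono)
next
  case (Suc n)
  then obtain m' where m: "m = Suc m'" "n \<le> m'" by (cases m) auto
  let ?d = "top_cond n"
  let ?x = "mean n (u \<circ> F q 1)" and ?y = "mean n (u \<circ> F q 2)"
  \<comment> \<open>These midpoints of the upper sides are also the tops of the two lower cells, by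
    \<open>F_swap\<close>.\<close>
  let ?r = "u (F q 0 (q 1))" and ?s = "u (F q 0 (q 2))"
  have d: "0 < ?d" by (rule top_cond_pos)
  have "min_energy (Suc n) u \<le> 5/3 * ((u (q 0) - ?r)^2 + (?r - ?s)^2 + (?s - u (q 0))^2
      + ?d * (?r - ?x)^2 + ?d * (?s - ?y)^2)
      + 5/3 * (row_energy n (u \<circ> F q 1) + row_energy n (u \<circ> F q 2))"
    unfolding min_energy_step [OF d] min_energy_def mean_Suc using d
    by (simp add: distrib_left)
  also have "\<dots> = 5/3 * (graph_energy q 0 (u \<circ> F q 0) + min_energy n (u \<circ> F q 1)
      + min_energy n (u \<circ> F q 2))"
    by (simp add: graph_energy_0 min_energy_def F_swap [of q 1 0] F_swap [of q 2 0] algebra_simps)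
  also have "\<dots> \<le> 5/3 * (graph_energy q m' (u \<circ> F q 0) + graph_energy q m' (u \<circ> F q 1)
      + graph_energy q m' (u \<circ> F q 2))"
    using m by (intro mult_left_mono add_mono Suc.IH graph_energy_mono) auto
  also have "\<dots> = graph_energy q m u"
    by (simp add: m graph_energy_Suc lessThan_3)
  finally show ?case .
qed

lemma row_and_top_eq: "row_and_top q n = insert (q 0) (row n)"
  by (simp add: row_and_top_def)

text \<open>A harmonic function in the upper cell is glued to inductive minimizers in the lower
  cells, with the midpoint values chosen to make the dropped squares vanish.\<close>

lemma min_energy_attained:
  "\<exists>u. continuous_on (SG q) u \<and> (\<forall>x\<in>row_and_top q n. u x = f x)
    \<and> (\<forall>m\<ge>n. graph_energy q m u = min_energy n f)"
proof (induction n arbitrary: f)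
  case 0
  let ?u = "harm (\<lambda>i. f (q i))"
  have "\<forall>x\<in>row_and_top q 0. ?u x = f x"
    unfolding row_and_top_eq row_0 by (simp add: harm_vertex)
  moreover have "graph_energy q m ?u = min_energy 0 f" for m
    by (simp add: min_energy_0 graph_energy_harm graph_energy_0)
  ultimately show ?case using continuous_on_harm by blast
next
  case (Suc n)
  define d where "d = top_cond n"
  define a where "a = f (q 0)"
  define x y where "x = mean n (f \<circ> F q 1)" and "y = mean n (f \<circ> F q 2)"
  \<comment> \<open>The mean and the difference of the optimal \<open>r\<close> and
    \<open>s\<close>, read off from the two squares at the end of
    \<open>min_energy_step\<close>.\<close>
  define \<sigma> \<tau> where "\<sigma> = a + d * ((x + y) / 2 - a) / (1 + d)" and "\<tau> = d * (x - y) / (3 + d)"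
  define r s where "r = \<sigma> + \<tau> / 2" and "s = \<sigma> - \<tau> / 2"
  have d: "0 < d" unfolding d_def by (rule top_cond_pos)
  have rs: "(r + s) / 2 - a - d * ((x + y) / 2 - a) / (1 + d) = 0"
    "r - s - d * (x - y) / (3 + d) = 0"
  proof -
    have *: "(r + s) / 2 = \<sigma>" "r - s = \<tau>" by (simp_all add: r_def s_def)
    show "(r + s) / 2 - a - d * ((x + y) / 2 - a) / (1 + d) = 0"
      "r - s - d * (x - y) / (3 + d) = 0"
      unfolding * by (simp_all add: \<sigma>_def \<tau>_def)
  qed
  \<comment> \<open>Only the value at the top of each lower cell is changed; the top is not in the
    row, so means and row energies stay the same.\<close>
  define f1 f2 where "f1 = (f \<circ> F q 1)(q 0 := r)" and "f2 = (f \<circ> F q 2)(q 0 := s)"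
  have f12: "f1 z = f (F q 1 z)" "f2 z = f (F q 2 z)" if "z \<in> row n" for z
  proof -
    have "z \<noteq> q 0" using that q_0_notin_row by metis
    then show "f1 z = f (F q 1 z)" "f2 z = f (F q 2 z)" by (simp_all add: f1_def f2_def)
  qed
  obtain u1 where u1: "continuous_on (SG q) u1" "\<forall>z\<in>row_and_top q n. u1 z = f1 z"
      "\<forall>m\<ge>n. graph_energy q m u1 = min_energy n f1"
    using Suc.IH [of f1] by blast
  obtain u2 where u2: "continuous_on (SG q) u2" "\<forall>z\<in>row_and_top q n. u2 z = f2 z"
      "\<forall>m\<ge>n. graph_energy q m u2 = min_energy n f2"
    using Suc.IH [of f2] by blast
  define u0 where "u0 = harm (\<lambda>j. if j = 0 then a else if j = 1 then r else s)"
  define g where "g i = (if i = 0 then u0 else if i = 1 then u1 else u2)" for i :: nat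
  have row_12: "u1 z = f (F q 1 z)" "u2 z = f (F q 2 z)" if "z \<in> row n" for z
    using that u1(2) u2(2) f12 unfolding row_and_top_eq by auto
  have top_12: "u1 (q 0) = r" "u2 (q 0) = s"
    using u1(2) u2(2) unfolding row_and_top_eq by (auto simp: f1_def f2_def)
  have vertex_0: "u0 (q 0) = a" "u0 (q 1) = r" "u0 (q 2) = s"
    by (simp_all add: u0_def harm_vertex)
  \<comment> \<open>The lower cells meet at the midpoint of the bottom side, a point of the row,
    where both pieces take the value of \<open>f\<close>.\<close>
  have mid: "u1 (q 2) = u2 (q 1)"
    using row_12(1) [OF ends_in_row(2)] row_12(2) [OF ends_in_row(1)] by (simp add: F_swap)
  have compat: "g i (q j) = g j (q i)" if "i < 3" "j < 3" for i j
    using that by (elim less_3_cases) (simp_all add: g_def vertex_0 top_12 mid)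
  have paste: "paste g (F q i z) = g i z" if "i < 3" "z \<in> SG q" for i z
    by (rule paste_F, rule compat) (use that in auto)
  have "continuous_on (SG q) (paste g)"
    by (rule continuous_on_paste, rule compat)
      (auto simp: g_def u0_def u1(1) u2(1) continuous_on_harm)
  moreover have "paste g z = f z" if "z \<in> row_and_top q (Suc n)" for z
  proof -
    have "paste g (q 0) = f (q 0)"
      using paste [of 0 "q 0"] by (simp add: vertex_in_SG g_def vertex_0 a_def)
    moreover have "paste g (F q 1 z) = f (F q 1 z)" "paste g (F q 2 z) = f (F q 2 z)"
      if "z \<in> row n" for z
      using that row_SG [of n] paste [of 1 z] paste [of 2 z] row_12 by (auto simp: g_def)
    ultimately show ?thesis
      using that unfolding row_and_top_eq row_Suc by auto
  qed
  moreover have "graph_energy q m (paste g) = min_energy (Suc n) f" if "m \<ge> Suc n" for m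
  proof -
    obtain m' where m: "m = Suc m'" "n \<le> m'"
      using \<open>m \<ge> Suc n\<close> by (cases m) auto
    have "graph_energy q m' (paste g \<circ> F q i) = graph_energy q m' (g i)" if "i < 3" for i
      by (rule graph_energy_cong) (simp add: paste that)
    then have "graph_energy q m (paste g)
        = 5/3 * (graph_energy q m' u0 + graph_energy q m' u1 + graph_energy q m' u2)"
      by (simp add: m graph_energy_Suc lessThan_3 g_def)
    also have "\<dots> = 5/3 * ((a - r)^2 + (r - s)^2 + (s - a)^2 + min_energy n f1 + min_energy n f2)"
      using m u1(3) u2(3) by (simp add: u0_def graph_energy_harm)
    also have "\<dots> = 5/3 * ((a - r)^2 + (r - s)^2 + (s - a)^2 + d * (r - x)^2 + d * (s - y)^2)
        + 5/3 * (row_energy n (f \<circ> F q 1) + row_energy n (f \<circ> F q 2))"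
    proof -
      have "mean n f1 = x" "mean n f2 = y" unfolding x_def y_def
        by (rule mean_cong; simp add: f12)+
      moreover have "row_energy n f1 = row_energy n (f \<circ> F q 1)"
        "row_energy n f2 = row_energy n (f \<circ> F q 2)"
        by (rule row_energy_cong; simp add: f12)+
      moreover have "f1 (q 0) = r" "f2 (q 0) = s" by (simp_all add: f1_def f2_def)
      ultimately show ?thesis
        by (simp add: min_energy_def d_def [symmetric] algebra_simps)
    qed
    also have "\<dots> = min_energy (Suc n) f"
      unfolding min_energy_step [OF d] rs
      by (simp add: min_energy_def mean_Suc d_def [symmetric] x_def [symmetric] y_def [symmetric]
          a_def [symmetric] distrib_left)
    finally show ?thesis .
  qed
  ultimately show ?case by blast
qed

text \<open>For a competitor \<open>v\<close>, already the graph energy at level \<open>n\<close> is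
  at least \<open>min_energy n v\<close>, which depends only on the values on the row and the
  top.\<close>

lemma min_extension_exists:
  obtains u where "is_min_extension q (row_and_top q n) f u" "energy q u = ereal (min_energy n f)"
proof -
  obtain u where u: "continuous_on (SG q) u" "\<forall>x\<in>row_and_top q n. u x = f x"
      "\<forall>m\<ge>n. graph_energy q m u = min_energy n f"
    using min_energy_attained by blast
  have e: "energy q u = ereal (min_energy n f)"
    using u(3) by (intro energy_eqI [of n]) auto
  have "energy q u \<le> energy q v" if v: "\<forall>x\<in>row_and_top q n. v x = f x" for v
  proof -
    have "mean n f = mean n v" "row_energy n f = row_energy n v"
      using v unfolding row_and_top_eq by (auto intro!: mean_cong row_energy_cong)
    then have "min_energy n f = min_energy n v"
      using v unfolding row_and_top_eq by (simp add: min_energy_def)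
    then have "energy q u \<le> ereal (graph_energy q n v)"
      by (simp add: e min_energy_le_graph_energy)
    also have "\<dots> \<le> energy q v" by (rule graph_energy_le_energy)
    finally show ?thesis .
  qed
  then have "is_min_extension q (row_and_top q n) f u"
    using u e by (simp add: is_min_extension_def dom_energy_def)
  then show ?thesis using e by (rule that)
qed

end

subsection \<open>Conductances\<close>

inductive diff_functional :: "'a set \<Rightarrow> (('a \<Rightarrow> real) \<Rightarrow> real) \<Rightarrow> bool" for A where
  diff: "x \<in> A \<Longrightarrow> y \<in> A \<Longrightarrow> diff_functional A (\<lambda>u. u x - u y)"
| add: "diff_functional A L \<Longrightarrow> diff_functional A M \<Longrightarrow> diff_functional A (\<lambda>u. L u + M u)"
| scale: "diff_functional A L \<Longrightarrow> diff_functional A (\<lambda>u. k * L u)"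

text \<open>These are the forms that conductances can represent. The factor \<open>k\<close> may be
  negative, as the polarization in \<open>laplace_form_mult\<close> requires.\<close>

inductive laplace_form :: "'a set \<Rightarrow> (('a \<Rightarrow> real) \<Rightarrow> real) \<Rightarrow> bool" for A where
  diff: "x \<in> A \<Longrightarrow> y \<in> A \<Longrightarrow> laplace_form A (\<lambda>u. (u x - u y)^2)"
| add: "laplace_form A P \<Longrightarrow> laplace_form A Q \<Longrightarrow> laplace_form A (\<lambda>u. P u + Q u)"
| scale: "laplace_form A Q \<Longrightarrow> laplace_form A (\<lambda>u. k * Q u)"

text \<open>A product of two differences is a combination of four squared differences by
  polarization; two nested inductions extend this bilinearly.\<close>

lemma laplace_form_mult:
  fixes A :: "'a set"
  assumes "diff_functional A L" "diff_functional A M"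
  shows "laplace_form A (\<lambda>u. L u * M u)"
  using assms(1)
proof induction
  case (diff x y)
  show ?case
    using assms(2)
  proof induction
    case (diff z w)
    have "(\<lambda>u :: 'a \<Rightarrow> real. (u x - u y) * (u z - u w))
      = (\<lambda>u. 1/2 * (((u x - u w)^2 + (u y - u z)^2) + -1 * ((u x - u z)^2 + (u y - u w)^2)))"
      by (rule ext) (simp add: power2_eq_square field_simps)
    moreover have "laplace_form A \<dots>"
      using diff \<open>x \<in> A\<close> \<open>y \<in> A\<close> by (intro laplace_form.intros)
    ultimately show ?case by (simp only:)
  next
    case (add L M)
    then show ?case using laplace_form.add by (simp add: distrib_left)
  next
    case (scale L k)
    then show ?case using laplace_form.scale [OF scale.IH, of k] by (simp add: mult_ac)
  qed
next
  case (add L M)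
  then show ?case using laplace_form.add by (simp add: distrib_right)
next
  case (scale L k)
  then show ?case using laplace_form.scale [OF scale.IH, of k] by (simp add: mult_ac)
qed

lemma laplace_form_square: "diff_functional A L \<Longrightarrow> laplace_form A (\<lambda>u. (L u)^2)"
  using laplace_form_mult [of A L L] by (simp add: power2_eq_square)

lemma laplace_form_comp:
  assumes "laplace_form A Q" "h ` A \<subseteq> B"
  shows "laplace_form B (\<lambda>u. Q (u \<circ> h))"
  using assms(1) by induction (use assms(2) in \<open>auto intro!: laplace_form.intros\<close>)

lemma laplace_form_mono: "laplace_form A Q \<Longrightarrow> A \<subseteq> B \<Longrightarrow> laplace_form B Q"
  using laplace_form_comp [of A Q id B] by simp

lemma laplace_form_conductances:
  assumes "laplace_form A Q" "finite A"
  obtains c where "\<And>x y. c x y = c y x"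
    "\<And>u. Q u = (\<Sum>x\<in>A. \<Sum>y\<in>A. c x y * (u x - u y)^2) / 2"
proof -
  have "\<exists>c. (\<forall>x y. c x y = c y x) \<and> (\<forall>u. Q u = (\<Sum>x\<in>A. \<Sum>y\<in>A. c x y * (u x - u y)^2) / 2)"
    using assms(1)
  proof induction
    case (diff v w)
    \<comment> \<open>Each ordering of the pair contributes once, which matches the division by 2.
      If \<open>v = w\<close>, the entry 2 on the diagonal multiplies a zero difference.\<close>
    define c where "c x y = (if x = v then if y = w then 1 else 0 else 0)
      + (if x = w then if y = v then 1 else (0::real) else 0)" for x y
    have "(\<Sum>x\<in>A. \<Sum>y\<in>A. c x y * (u x - u y)^2) = 2 * (u v - u w)^2" for u
    proof -
      have "(\<Sum>y\<in>A. c x y * (u x - u y)^2)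
          = (if x = v then (u v - u w)^2 else 0) + (if x = w then (u w - u v)^2 else 0)" for x
      proof -
        have "c x y * (u x - u y)^2 = (if y = w then if x = v then (u v - u w)^2 else 0 else 0)
            + (if y = v then if x = w then (u w - u v)^2 else 0 else 0)" for y
          by (auto simp: c_def)
        then show ?thesis using diff assms(2) by (simp add: sum.distrib)
      qed
      then show ?thesis using diff assms(2) by (simp add: sum.distrib power2_commute)
    qed
    moreover have "c x y = c y x" for x y by (simp add: c_def)
    ultimately show ?case by (intro exI [of _ c]) simp
  next
    case (add P Q)
    obtain c where c: "\<And>x y. c x y = c y x"
      "\<And>u. P u = (\<Sum>x\<in>A. \<Sum>y\<in>A. c x y * (u x - u y)^2) / 2"
      using add.IH(1) by blast
    obtain c' where c': "\<And>x y. c' x y = c' y x"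
      "\<And>u. Q u = (\<Sum>x\<in>A. \<Sum>y\<in>A. c' x y * (u x - u y)^2) / 2"
      using add.IH(2) by blast
    have "c x y + c' x y = c y x + c' y x" for x y
      by (simp add: c(1) [of x y] c'(1) [of x y])
    then show ?case
      by (intro exI [of _ "\<lambda>x y. c x y + c' x y"])
        (simp add: c(2) c'(2) distrib_right sum.distrib add_divide_distrib)
  next
    case (scale Q k)
    obtain c where c: "\<And>x y. c x y = c y x"
      "\<And>u. Q u = (\<Sum>x\<in>A. \<Sum>y\<in>A. c x y * (u x - u y)^2) / 2"
      using scale.IH by blast
    have "k * c x y = k * c y x" for x y
      by (simp add: c(1) [of x y])
    then show ?case
      by (intro exI [of _ "\<lambda>x y. k * c x y"]) (simp add: c(2) sum_distrib_left mult.assoc)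
  qed
  then show ?thesis using that by blast
qed

definition dirac :: "'a \<Rightarrow> 'a \<Rightarrow> real" where
  "dirac x z = (if z = x then 1 else 0)"

text \<open>The cross term of two point masses sees only the edge between them, so the form
  determines its coefficients.\<close>

lemma conductance_polarization:
  assumes A: "finite A" "x \<in> A" "y \<in> A" "x \<noteq> y" and sym: "\<And>x y. c x y = c y x"
    and Q: "\<And>u. Q u = (\<Sum>x\<in>A. \<Sum>y\<in>A. c x y * (u x - u y)^2) / 2"
  shows "c x y = - (Q (\<lambda>z. dirac x z + dirac y z) - Q (dirac x) - Q (dirac y)) / 2"
proof -
  let ?f = "\<lambda>z. dirac x z + dirac y z"
  have "c v w * (?f v - ?f w)^2 - c v w * (dirac x v - dirac x w)^2
      - c v w * (dirac y v - dirac y w)^2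
      = (if v = x then if w = y then - 2 * c x y else 0 else 0)
      + (if v = y then if w = x then - 2 * c x y else 0 else 0)" for v w
    using A(4) sym [of x y] by (auto simp: dirac_def)
  then have "2 * (Q ?f - Q (dirac x) - Q (dirac y))
    = (\<Sum>v\<in>A. \<Sum>w\<in>A. (if v = x then if w = y then - 2 * c x y else 0 else 0)
      + (if v = y then if w = x then - 2 * c x y else 0 else 0))"
    unfolding Q by (simp add: diff_divide_distrib flip: sum_subtractf)
  also have "\<dots> = (\<Sum>v\<in>A. (if v = x then - 2 * c x y else 0) + (if v = y then - 2 * c x y else 0))"
    by (rule sum.cong [OF refl]) (use A in \<open>auto simp: sum.distrib\<close>)
  also have "\<dots> = - 4 * c x y"
    using A by (simp add: sum.distrib)
  finally show ?thesis by simp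
qed

section \<open>Existence and uniqueness of the conductances\<close>

context equilateral_triangle
begin

text \<open>The map \<open>h\<close> is there for the induction: it accumulates \<open>F q 1\<close>
  and \<open>F q 2\<close> as the row is halved.\<close>

lemma diff_functional_mean:
  assumes "x \<in> A" "h ` row n \<subseteq> A"
  shows "diff_functional A (\<lambda>u. u x - mean n (u \<circ> h))"
  using assms(2)
proof (induction n arbitrary: h)
  case 0
  have "(\<lambda>u. u x - mean 0 (u \<circ> h)) = (\<lambda>u. 1/2 * ((u x - u (h (q 1))) + (u x - u (h (q 2)))))"
    by (simp add: mean_0 field_simps)
  moreover have "diff_functional A \<dots>"
    using assms(1) 0 unfolding row_0 by (intro diff_functional.intros) auto
  ultimately show ?case by (simp only:)
next
  case (Suc n)
  have "(h \<circ> F q 1) ` row n \<subseteq> A" "(h \<circ> F q 2) ` row n \<subseteq> A"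
    using Suc.prems unfolding row_Suc by auto
  note 1 = this [THEN Suc.IH]
  have "(\<lambda>u. u x - mean (Suc n) (u \<circ> h))
      = (\<lambda>u. 1/2 * ((u x - mean n (u \<circ> (h \<circ> F q 1))) + (u x - mean n (u \<circ> (h \<circ> F q 2)))))"
    by (simp add: mean_Suc o_assoc field_simps)
  moreover have "diff_functional A \<dots>"
    by (intro diff_functional.intros 1)
  ultimately show ?case by (simp only:)
qed

lemma laplace_form_row_energy: "laplace_form (row n) (row_energy n)"
proof (induction n)
  case 0
  show ?case unfolding row_0 row_energy.simps
    by (intro laplace_form.intros) auto
next
  case (Suc n)
  have sub: "F q 1 ` row n \<subseteq> row (Suc n)" "F q 2 ` row n \<subseteq> row (Suc n)"
    unfolding row_Suc by auto
  \<comment> \<open>Subtracting both means from the value at one point of the row reduces the claim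
    to \<open>diff_functional_mean\<close>.\<close>
  have "(\<lambda>u. mean n (u \<circ> F q 1) - mean n (u \<circ> F q 2))
      = (\<lambda>u. (u (q 1) - mean n (u \<circ> F q 2)) + -1 * (u (q 1) - mean n (u \<circ> F q 1)))"
    by simp
  moreover have "diff_functional (row (Suc n)) \<dots>"
    by (intro diff_functional.intros diff_functional_mean sub ends_in_row)
  ultimately have "laplace_form (row (Suc n))
      (\<lambda>u. (mean n (u \<circ> F q 1) - mean n (u \<circ> F q 2))^2)"
    by (intro laplace_form_square) (simp only:)
  then show ?case unfolding row_energy.simps
    by (intro laplace_form.intros laplace_form_comp [OF Suc.IH] sub)
qed

lemma laplace_form_min_energy: "laplace_form (row_and_top q n) (min_energy n)"
proof -
  have "diff_functional (row_and_top q n) (\<lambda>u. u (q 0) - mean n (u \<circ> id))"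
    by (rule diff_functional_mean) (auto simp: row_and_top_eq)
  then have "laplace_form (row_and_top q n) (\<lambda>u. (u (q 0) - mean n u)^2)"
    by (intro laplace_form_square) simp
  then have "laplace_form (row_and_top q n)
      (\<lambda>u. top_cond n * (u (q 0) - mean n u)^2 + row_energy n u)"
    by (intro laplace_form.intros laplace_form_mono [OF laplace_form_row_energy])
      (auto simp: row_and_top_eq)
  then show ?thesis by (simp add: min_energy_def [abs_def])
qed

lemma finite_row_and_top: "finite (row_and_top q n)"
  by (simp add: row_and_top_def)

text \<open>The definition speaks of some minimizer for \<open>f\<close>; all minimizers have the
  same energy and the same values on the set.\<close>

lemma is_conductances_energy:
  assumes "is_conductances q (row_and_top q n) c"
  shows "min_energy n f
    = (\<Sum>x\<in>row_and_top q n. \<Sum>y\<in>row_and_top q n. c x y * (f x - f y)^2) / 2"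
proof -
  let ?A = "row_and_top q n"
  obtain u where u: "is_min_extension q ?A f u"
      "energy q u = ereal ((\<Sum>x\<in>?A. \<Sum>y\<in>?A. c x y * (u x - u y)^2) / 2)"
    using assms unfolding is_conductances_def by blast
  obtain v where v: "is_min_extension q ?A f v" "energy q v = ereal (min_energy n f)"
    by (rule min_extension_exists)
  have "energy q u = energy q v"
    using u(1) v(1) unfolding is_min_extension_def by (blast intro: antisym)
  moreover have "(\<Sum>x\<in>?A. \<Sum>y\<in>?A. c x y * (u x - u y)^2)
      = (\<Sum>x\<in>?A. \<Sum>y\<in>?A. c x y * (f x - f y)^2)"
    using u(1) unfolding is_min_extension_def by (intro sum.cong) auto
  ultimately show ?thesis using u(2) v(2) by simp
qed

lemma is_conductances_unique:
  assumes "is_conductances q (row_and_top q n) c"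
    and "x \<in> row_and_top q n" "y \<in> row_and_top q n" "x \<noteq> y"
  shows "c x y
    = - (min_energy n (\<lambda>z. dirac x z + dirac y z) - min_energy n (dirac x) - min_energy n (dirac y)) / 2"
proof (rule conductance_polarization [OF finite_row_and_top assms(2-4)])
  show "c x y = c y x" for x y using assms(1) by (simp add: is_conductances_def)
qed (rule is_conductances_energy [OF assms(1)])

lemma is_conductances_exists: "\<exists>c. is_conductances q (row_and_top q n) c"
proof -
  let ?A = "row_and_top q n"
  obtain c where sym: "\<And>x y. c x y = c y x"
    and c: "\<And>u. min_energy n u = (\<Sum>x\<in>?A. \<Sum>y\<in>?A. c x y * (u x - u y)^2) / 2"
    using laplace_form_conductances [OF laplace_form_min_energy finite_row_and_top] by blast
  \<comment> \<open>Clearing the entries off the set and on the diagonal meets the normalization in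
    \<open>is_conductances\<close> and leaves the sums unchanged.\<close>
  define c' where "c' x y = (if x \<in> ?A \<and> y \<in> ?A \<and> x \<noteq> y then c x y else 0)" for x y
  have "\<exists>u. is_min_extension q ?A f u \<and>
      energy q u = ereal ((\<Sum>x\<in>?A. \<Sum>y\<in>?A. c' x y * (u x - u y)^2) / 2)" for f
  proof -
    obtain u where u: "is_min_extension q ?A f u" "energy q u = ereal (min_energy n f)"
      by (rule min_extension_exists)
    have "(\<Sum>x\<in>?A. \<Sum>y\<in>?A. c' x y * (u x - u y)^2) = (\<Sum>x\<in>?A. \<Sum>y\<in>?A. c x y * (f x - f y)^2)"
      using u(1) unfolding is_min_extension_def by (intro sum.cong) (auto simp: c'_def)
    then show ?thesis using u c [of f] by auto
  qed
  then have "is_conductances q ?A c'"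
    unfolding is_conductances_def using sym by (auto simp: c'_def)
  then show ?thesis by blast
qed

lemma conductance_eq:
  assumes "x \<in> row_and_top q n" "y \<in> row_and_top q n" "x \<noteq> y"
  shows "conductance q (row_and_top q n) x y
    = - (min_energy n (\<lambda>z. dirac x z + dirac y z) - min_energy n (dirac x) - min_energy n (dirac y)) / 2"
proof -
  obtain c where c: "is_conductances q (row_and_top q n) c"
    using is_conductances_exists by blast
  have "c' = c" if c': "is_conductances q (row_and_top q n) c'" for c'
  proof (intro ext)
    fix x y
    show "c' x y = c x y"
    proof (cases "x \<in> row_and_top q n \<and> y \<in> row_and_top q n \<and> x \<noteq> y")
      case True
      then show ?thesis
        using is_conductances_unique [OF c, of x y] is_conductances_unique [OF c', of x y] by metis
    next
      case False
      then have "c x y = 0" "c' x y = 0"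
        using c c' unfolding is_conductances_def by blast+
      then show ?thesis by simp
    qed
  qed
  then have "conductance q (row_and_top q n) = c"
    unfolding conductance_def by (intro the_equality c)
  then show ?thesis using is_conductances_unique [OF c assms] by simp
qed

section \<open>Conductances between the two halves of the row\<close>

text \<open>A point of the row that is not an end belongs to two edges of the row, an end to one;
  the two sums count right-hand and left-hand edges.\<close>

lemma mean_dirac:
  assumes "i \<le> 2^n"
  shows "mean n (dirac (bottom_pt q n i)) = (if i = 0 \<or> i = 2^n then 1 else 2) / 2 ^ Suc n"
proof -
  have "(\<Sum>k<2^n. dirac (bottom_pt q n i) (bottom_pt q n k)) = (if i < 2^n then 1 else 0)"
    by (simp add: dirac_def bottom_pt_eq_iff)
  moreover have "(\<Sum>k<2^n. dirac (bottom_pt q n i) (bottom_pt q n (Suc k))) = (if i = 0 then 0 else 1)"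
    unfolding dirac_def bottom_pt_eq_iff using assms by (cases i) auto
  ultimately show ?thesis
    using assms by (auto simp: mean_def sum.distrib)
qed

lemma row_energy_zero: "row_energy n (\<lambda>_. 0) = 0"
  by (induction n) (simp_all add: o_def mean_def)

text \<open>Both points differ from the midpoint, so each point mass lives in one half only.\<close>

lemma row_conductance_Suc:
  assumes i: "i < 2^n" and j: "2^n < j" "j \<le> 2 ^ Suc n"
  shows "row_conductance q (Suc n) i j
    = mean n (dirac (bottom_pt q n i)) * mean n (dirac (bottom_pt q n (j - 2^n)))
      * (5 * (top_cond n)^2 / (3 * (3 + top_cond n) * (1 + top_cond n)))"
proof -
  define x y where "x = bottom_pt q (Suc n) i" and "y = bottom_pt q (Suc n) j"
  define d where "d = top_cond n"
  have d: "0 < d" unfolding d_def by (rule top_cond_pos)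
  let ?x = "dirac (bottom_pt q n i)" and ?y = "dirac (bottom_pt q n (j - 2^n))"
  let ?f = "\<lambda>z. dirac x z + dirac y z"
  have mem: "x \<in> row (Suc n)" "y \<in> row (Suc n)" using i j by (auto simp: x_def y_def)
  have x1: "(dirac x \<circ> F q 1) z = ?x z" and x2: "(dirac x \<circ> F q 2) z = 0"
    and y1: "(dirac y \<circ> F q 1) z = 0" and y2: "(dirac y \<circ> F q 2) z = ?y z"
    if "z \<in> row n" for z
  proof -
    obtain k where k: "z = bottom_pt q n k" "k \<le> 2^n" using \<open>z \<in> row n\<close> by auto
    show "(dirac x \<circ> F q 1) z = ?x z" "(dirac x \<circ> F q 2) z = 0"
      "(dirac y \<circ> F q 1) z = 0" "(dirac y \<circ> F q 2) z = ?y z"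
      using i j k by (auto simp: x_def y_def F_1_bottom_pt F_2_bottom_pt dirac_def bottom_pt_eq_iff)
  qed
  have f: "(?f \<circ> F q 1) z = ?x z" "(?f \<circ> F q 2) z = ?y z" if "z \<in> row n" for z
    using x1 [OF that] x2 [OF that] y1 [OF that] y2 [OF that] by simp_all
  define \<alpha> \<beta> where "\<alpha> = mean n ?x" and "\<beta> = mean n ?y"
  have zero: "mean n u = 0" "row_energy n u = 0" if "\<And>z. z \<in> row n \<Longrightarrow> u z = 0" for u
    using mean_cong [of n u "\<lambda>_. 0"] row_energy_cong [of n u "\<lambda>_. 0"] that row_energy_zero [of n]
    by (simp_all add: mean_def)
  have m: "mean n (dirac x \<circ> F q 1) = \<alpha>" "mean n (dirac y \<circ> F q 2) = \<beta>"
    "mean n (?f \<circ> F q 1) = \<alpha>" "mean n (?f \<circ> F q 2) = \<beta>"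
    unfolding \<alpha>_def \<beta>_def by (rule mean_cong, erule x1 y2 f)+
  have r: "row_energy n (dirac x \<circ> F q 1) = row_energy n ?x"
    "row_energy n (dirac y \<circ> F q 2) = row_energy n ?y"
    "row_energy n (?f \<circ> F q 1) = row_energy n ?x" "row_energy n (?f \<circ> F q 2) = row_energy n ?y"
    by (rule row_energy_cong, erule x1 y2 f)+
  have z: "mean n (dirac x \<circ> F q 2) = 0" "row_energy n (dirac x \<circ> F q 2) = 0"
    "mean n (dirac y \<circ> F q 1) = 0" "row_energy n (dirac y \<circ> F q 1) = 0"
    by (rule zero, erule x2 y1)+
  have top: "dirac x (q 0) = 0" "dirac y (q 0) = 0"
    using mem q_0_notin_row [of "Suc n"] by (auto simp: dirac_def)
  define k l where "k = 10/3 * d / (1 + d)" and "l = 3 * d / (2 * (3 + d))"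
  \<comment> \<open>The row energies of the halves cancel. What remains are the cross terms of the
    square of the overall mean, with coefficient \<open>k\<close>, and of the squared difference of
    the means, with \<open>5/3 * l\<close>.\<close>
  have "min_energy (Suc n) ?f - min_energy (Suc n) (dirac x) - min_energy (Suc n) (dirac y)
    = \<alpha> * \<beta> * (k / 2 - 10/3 * l)"
    unfolding min_energy_def mean_Suc row_energy.simps m r z top top_cond.simps
      d_def [symmetric] k_def [symmetric] l_def [symmetric]
    by (simp add: power2_eq_square field_simps)
  moreover have "x \<noteq> y" using i j by (simp add: x_def y_def bottom_pt_eq_iff)
  ultimately have "row_conductance q (Suc n) i j = \<alpha> * \<beta> * (5/3 * l - k / 4)"
    using mem unfolding row_conductance_def x_def [symmetric] y_def [symmetric]
    by (subst conductance_eq) (simp_all add: row_and_top_eq right_diff_distrib)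
  also have "5/3 * l - k / 4 = 5 * d^2 / (3 * (3 + d) * (1 + d))"
    unfolding k_def l_def using d
    by (simp add: power2_eq_square divide_simps) (simp add: algebra_simps)
  finally show ?thesis unfolding \<alpha>_def \<beta>_def d_def .
qed

text \<open>The reciprocal of \<open>top_cond\<close> obeys the affine recursion
  \<open>x' = 3/10 * (x + 1)\<close> with fixed point 3/7, which explains the closed form.\<close>

lemma top_cond_eq: "top_cond n = 14 * 10^n / (6 * 10^n + 3^n)"
proof (induction n)
  case (Suc n)
  define A B :: real where "A = 10^n" and "B = 3^n"
  have "A > 0" "B > 0" by (simp_all add: A_def B_def)
  then show ?case
    unfolding top_cond.simps Suc power_Suc A_def [symmetric] B_def [symmetric]
    by (simp add: divide_simps add_pos_pos) (simp add: algebra_simps)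
qed simp

lemma end_conductance:
  "row_conductance q (Suc n) 0 (2 ^ Suc n)
    = (49 * 25 ^ Suc n) / ((5 * 3 ^ Suc n + 16 * 10 ^ Suc n) * (3 ^ Suc n + 6 * 10 ^ Suc n))"
proof -
  define A B C D :: real where "A = 10^n" and "B = 3^n" and "C = 25^n" and "D = 2^n"
  have pos: "A > 0" "B > 0" "D > 0" by (simp_all add: A_def B_def D_def)
  \<comment> \<open>Since 100 = 25 * 4, the weights \<open>1 / (2 * D)\<close> of the two ends turn
    the square of \<open>10^n\<close> into \<open>25^n\<close>.\<close>
  have A: "A * A = C * (D * D)"
    by (simp add: A_def C_def D_def flip: power_mult_distrib)
  have d: "top_cond n = 14 * A / (6 * A + B)" by (simp add: top_cond_eq A_def B_def)
  have d3: "3 + top_cond n = (32 * A + 3 * B) / (6 * A + B)"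
    and d1: "1 + top_cond n = (20 * A + B) / (6 * A + B)"
    unfolding d using pos by (simp_all add: field_simps)
  have "row_conductance q (Suc n) 0 (2 ^ Suc n) = (1 / (2 * D)) * (1 / (2 * D))
      * (5 * (top_cond n)^2 / (3 * (3 + top_cond n) * (1 + top_cond n)))"
  proof -
    have "(2::nat) ^ Suc n - 2^n = 2^n" by simp
    moreover have "mean n (dirac (bottom_pt q n 0)) = 1 / (2 * D)"
      "mean n (dirac (bottom_pt q n (2^n))) = 1 / (2 * D)"
      by (subst mean_dirac; simp add: D_def)+
    ultimately show ?thesis by (subst row_conductance_Suc) simp_all
  qed
  also have "\<dots> = 245 * (A * A) / (D * D) / (3 * (32 * A + 3 * B) * (20 * A + B))"
  proof -
    have gen: "(1 / (2 * D)) * (1 / (2 * D)) * (5 * (14 * A / S)^2 / (3 * (X / S) * (Y / S)))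
        = 245 * (A * A) / (D * D) / (3 * X * Y)" if "S > 0" "X > 0" "Y > 0" for S X Y
      using that pos by (simp add: power2_eq_square divide_simps)
    show ?thesis unfolding d3 d1 unfolding d by (rule gen) (use pos in simp_all)
  qed
  also have "\<dots> = 245 * C / (3 * (32 * A + 3 * B) * (20 * A + B))"
    unfolding A using pos by simp
  also have "\<dots> = (49 * (25 * C)) / ((5 * (3 * B) + 16 * (10 * A)) * (3 * B + 6 * (10 * A)))"
  proof -
    have "(5 * (3 * B) + 16 * (10 * A)) * (3 * B + 6 * (10 * A))
        = 5 * (3 * (32 * A + 3 * B) * (20 * A + B))" by (simp add: algebra_simps)
    then show ?thesis by simp
  qed
  finally show ?thesis by (simp add: A_def B_def C_def)
qed

end

theorem lemma2p18:
  fixes q :: "nat \<Rightarrow> real^2" and n :: nat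
  assumes "equilateral q" and "n \<ge> 1"
  shows "(\<forall>j. 2^(n-1) < j \<and> j < 2^n \<longrightarrow> row_conductance q n 0 j = 2 * b_end q n)
    \<and> (\<forall>j. 0 < j \<and> j < 2^(n-1) \<longrightarrow> row_conductance q n j (2^n) = 2 * b_end q n)
    \<and> (\<forall>i j. 0 < i \<and> i < 2^(n-1) \<and> 2^(n-1) < j \<and> j < 2^n
          \<longrightarrow> row_conductance q n i j = 4 * b_end q n)
    \<and> b_end q n = (49 * 25^n) / ((5 * 3^n + 16 * 10^n) * (3^n + 6 * 10^n))"
proof -
  interpret equilateral_triangle q by standard (rule assms(1))
  obtain m where n: "n = Suc m" using assms(2) by (cases n) auto
  define D :: real where "D = 2 ^ Suc m"
  define K where "K = 5 * (top_cond m)^2 / (3 * (3 + top_cond m) * (1 + top_cond m))"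
  \<comment> \<open>Relative weights are 1 at the outer ends and 2 elsewhere, which produces the
    ratios 1, 2 and 4. The inner end of each half is the midpoint, which the strict inequalities
    exclude.\<close>
  have c: "row_conductance q n i j = (if i = 0 then 1 else 2) / D * ((if j = 2^n then 1 else 2) / D) * K"
    if "i < 2^m" "2^m < j" "j \<le> 2^n" for i j
  proof -
    have "mean m (dirac (bottom_pt q m i)) = (if i = 0 then 1 else 2) / D"
      using that(1) by (subst mean_dirac) (auto simp: D_def)
    moreover have "mean m (dirac (bottom_pt q m (j - 2^m))) = (if j = 2^n then 1 else 2) / D"
      using that(2,3) by (subst mean_dirac) (auto simp: D_def n)
    ultimately show ?thesis
      unfolding K_def n by (subst row_conductance_Suc) (use that n in simp_all)
  qed
  have b: "b_end q n = 1 / D * (1 / D) * K"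
    unfolding b_end_def using c [of 0 "2^n"] by (simp add: n)
  have "b_end q n = (49 * 25^n) / ((5 * 3^n + 16 * 10^n) * (3^n + 6 * 10^n))"
    unfolding b_end_def n by (rule end_conductance)
  moreover have "n - 1 = m" by (simp add: n)
  moreover have "(2::nat)^m < 2^n" by (simp add: n)
  ultimately show ?thesis
    using c b by auto
qed

end
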